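(* Let $P_D[X_D|\Theta_D]$ be the projective limit of a projective family $\langle P_I[X_I|\Theta_I]\rangle_{I\in D}$ of parametrized models, and let $\langle\mathcal{S}_I\rangle_{I\in D}$ be a directed family of $\sigma$-algebras $\mathcal{S}_I\subset\mathcal{A}$. Suppose that each $\mathcal{S}_I$ is minimal sufficient for $P_I[X_I|\Theta_I]$. Then $\mathcal{S}_D=\sigma(\mathcal{S}_I;I\in D)$ is minimal sufficient for $P_D[X_D|\Theta_D]$.
   Context: $(\Omega,\mathcal{A},\mathbb{P})$ is an abstract probability space, the common domain of all random variables. Projective system: $(D,\preceq)$ is a countable directed partially ordered set; the $\mathcal{X}_I$ are Polish spaces with Borel $\sigma$-algebras $\mathcal{B}_I$; $f_{JI}:\mathcal{X}_J\to\mathcal{X}_I$ ($I\preceq J$) are continuous with $f_{II}=\mathrm{Id}$ and $f_{KI}=f_{JI}\circ f_{KJ}$ for $I\preceq J\preceq K$. The projective limit $\mathcal{X}_D$ is the set of all $(x_I)\in\prod_I\mathcal{X}_I$ with $x_I=f_{JI}x_J$ for $I\preceq J$, with canonical maps $f_I:(x_J)_J\mapsto x_I$ and the $\sigma$-algebra $\mathcal{B}_D=\sigma(f_I;I\in D)$. A family $\langle\mathcal{S}_I\rangle$ of $\sigma$-algebras is directed if $\mathcal{S}_I\subset\mathcal{S}_J$ whenever $I\preceq J$. Parametrized model: $P[X|\Theta]$ is the regular conditional probability of an observation variable $X:\Omega\to\mathcal{X}$ given a parameter variable $\Theta:\Omega\to\mathcal{T}$, where $X$ is the generic element of an exchangeable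 sequence $X^\infty$, and $\Theta=\Psi\circ F\circ X^{\infty}$ with $F$ the map to probability measures on $\mathcal{X}$ induced by the limiting empirical measure and $\Psi$ a bimeasurable map from the image $(F\circ X^\infty)(\Omega)$ onto a measurable space $\mathcal{T}$. Projective limit model: the observation spaces form a projective system $\langle\mathcal{X}_I,\mathcal{B}_I,f_{JI}\rangle_{I\preceq J\in D}$ of Polish spaces $\mathcal{X}_I$ with Borel $\sigma$-algebras $\mathcal{B}_I$, indexed by the countable directed set $D$, with continuous maps $f_{JI}:\mathcal{X}_J\to\mathcal{X}_I$ satisfying $f_{II}=\mathrm{Id}$ and $f_{KI}=f_{JI}\circ f_{KJ}$ for $I\preceq J\preceq K$, and the parameter spaces a projective system $\langle\mathcal{T}_I,\mathcal{B}(\mathcal{T}_I),g_{JI}\rangle$; the variables satisfy $X_I=f_{JI}X_J$, $\Theta_I=g_{JI}\Theta_J$; and the kernels $P_I[\,\cdot\,|\Theta_I]$ are projective, i.e. $P_J[f_{JI}^{-1}\,\cdot\,|\Theta_J]=P_I[\,\cdot\,|\Theta_I]$ $\mathbb{P}$-a.e. for $I\preceq J$. $X_D$, $\Theta_D$ are the projective limit variables ($f_IX_D=X_I$, $g_I\Theta_D=\Theta_I$), $\sigma(\Theta_D)=\sigma(\Theta_I;I\in D)$, and $P_D[\,\cdot\,|\Theta_D]$ is the unique (up to equivalence) $\sigma(\Theta_D)$-measurable kernel with $P_D[f_I^{-1}\,\cdot\,|\Theta_D]=P_I[\,\cdot\,|\Theta_I]$ a.e. for all $I$. Sufficiency: a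 $\sigma$-algebra $\mathcal{S}\subset\mathcal{A}$ is sufficient for $P[X|\Theta]$ if there is a probability kernel $k:\mathcal{A}\times\Omega\to[0,1]$ such that for all $B\in\mathcal{B}(\mathcal{X})$: $\omega\mapsto k(X^{-1}B,\omega)$ is $\mathcal{S}$-measurable, and $P[B|\Theta,\mathcal{S}](\omega)=k(X^{-1}B,\omega)$ $\mathbb{P}$-a.s. Minimal sufficiency: a $\sigma$-algebra $\mathcal{S}_0\subset\mathcal{A}$ is minimal sufficient for $P[X|\Theta]$ if it is sufficient, and if every other sufficient $\sigma$-algebra $\mathcal{C}\subset\mathcal{A}$ satisfies: for every $A\in\mathcal{S}_0$ there is $C\in\mathcal{C}$ with $\mathbb{P}[A\triangle C|\Theta=\theta]=0$ for all $\theta\in\mathcal{T}$.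
   Formalization: It is assumed that a regular conditional probability P[·|Θ_D=θ] on (Ω,𝒜) exists, without which the claim fails for abstract Ω; and "P[A△C|Θ=θ]=0 for all θ" is understood for some version of the conditional probability, which may depend on A and C. *)

theory Defs
  imports "HOL-Probability.Probability"
begin

section \<open>Polish spaces and projective systems\<close>

text \<open>All spaces of a system are carried by one type. This is no restriction, since the type
  variable is arbitrary (for instance a disjoint union).\<close>

definition polish_space :: "'x topology \<Rightarrow> bool" where
  "polish_space X \<longleftrightarrow> completely_metrizable_space X \<and> separable_space X"

definition borel_of :: "'x topology \<Rightarrow> 'x measure" where
  "borel_of X = sigma (topspace X) {U. openin X U}"

locale projective_system =
  fixes D :: "'i::order set"
    and X :: "'i \<Rightarrow> 'x topology"
    and f :: "'i \<Rightarrow> 'i \<Rightarrow> 'x \<Rightarrow> 'x"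
  assumes D_countable: "countable D"
    and D_nonempty: "D \<noteq> {}"
    and D_directed: "\<And>I J. I \<in> D \<Longrightarrow> J \<in> D \<Longrightarrow> \<exists>K\<in>D. I \<le> K \<and> J \<le> K"
    and polish: "\<And>I. I \<in> D \<Longrightarrow> polish_space (X I)"
    and f_continuous: "\<And>I J. I \<in> D \<Longrightarrow> J \<in> D \<Longrightarrow> I \<le> J \<Longrightarrow> continuous_map (X J) (X I) (f J I)"
    and f_refl: "\<And>I x. I \<in> D \<Longrightarrow> x \<in> topspace (X I) \<Longrightarrow> f I I x = x"
    and f_trans: "\<And>I J K x. I \<in> D \<Longrightarrow> J \<in> D \<Longrightarrow> K \<in> D \<Longrightarrow> I \<le> J \<Longrightarrow> J \<le> K \<Longrightarrow>
      x \<in> topspace (X K) \<Longrightarrow> f K I x = f J I (f K J x)"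

definition proj_lim_set ::
    "'i::order set \<Rightarrow> ('i \<Rightarrow> 'x topology) \<Rightarrow> ('i \<Rightarrow> 'i \<Rightarrow> 'x \<Rightarrow> 'x) \<Rightarrow> ('i \<Rightarrow> 'x) set" where
  "proj_lim_set D X f =
    {x \<in> (\<Pi>\<^sub>E I\<in>D. topspace (X I)). \<forall>I\<in>D. \<forall>J\<in>D. I \<le> J \<longrightarrow> x I = f J I (x J)}"

text \<open>The projective limit with the \<open>\<sigma>\<close>-algebra generated by the coordinate maps \<open>x \<mapsto> x I\<close>.\<close>

definition proj_lim ::
    "'i::order set \<Rightarrow> ('i \<Rightarrow> 'x topology) \<Rightarrow> ('i \<Rightarrow> 'i \<Rightarrow> 'x \<Rightarrow> 'x) \<Rightarrow> ('i \<Rightarrow> 'x) measure" where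
  "proj_lim D X f = sigma (proj_lim_set D X f)
    {(\<lambda>x. x I) -` B \<inter> proj_lim_set D X f | I B. I \<in> D \<and> B \<in> sets (borel_of (X I))}"

text \<open>The only variable with coordinates \<open>X I\<close>; functions in \<open>\<Pi>\<^sub>E\<close> are \<open>undefined\<close> off \<open>D\<close>.\<close>

definition proj_lim_var :: "'i set \<Rightarrow> ('i \<Rightarrow> 'w \<Rightarrow> 'x) \<Rightarrow> 'w \<Rightarrow> 'i \<Rightarrow> 'x" where
  "proj_lim_var D X \<omega> = (\<lambda>I\<in>D. X I \<omega>)"


section \<open>Conditional probabilities\<close>

text \<open>A \<open>\<sigma>\<close>-algebra on \<open>\<Omega> = space M\<close> is represented by a measure of which only \<open>space\<close> and \<open>sets\<close>
  are used, as in the library's \<open>subalgebra\<close> and \<open>real_cond_exp\<close>.\<close>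

abbreviation gen_by :: "'w measure \<Rightarrow> ('w \<Rightarrow> 't) \<Rightarrow> 't measure \<Rightarrow> 'w measure" where
  "gen_by M \<Theta> T \<equiv> vimage_algebra (space M) \<Theta> T"

definition cond_prob_on :: "'w measure \<Rightarrow> 'w measure \<Rightarrow> 'w set \<Rightarrow> 'w \<Rightarrow> real" where
  "cond_prob_on M G A = real_cond_exp M G (indicat_real A)"

text \<open>The regular conditional probability \<open>P[X|\<Theta>]\<close>, as a \<open>\<sigma>(\<Theta>)\<close>-measurable kernel.\<close>

definition regular_cond_law ::
    "'w measure \<Rightarrow> 'x measure \<Rightarrow> ('w \<Rightarrow> 'x) \<Rightarrow> 't measure \<Rightarrow> ('w \<Rightarrow> 't) \<Rightarrow> ('w \<Rightarrow> 'x measure) \<Rightarrow> bool" where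
  "regular_cond_law M N X T \<Theta> p \<longleftrightarrow>
    p \<in> gen_by M \<Theta> T \<rightarrow>\<^sub>M prob_algebra N \<and>
    (\<forall>B\<in>sets N. AE \<omega> in M.
      measure (p \<omega>) B = cond_prob_on M (gen_by M \<Theta> T) (X -` B \<inter> space M) \<omega>)"

text \<open>\<open>Q\<close> is a version of \<open>\<theta> \<mapsto> P[ \<cdot> |\<Theta> = \<theta>]\<close>, a kernel from the parameter space to the sample space.
  On an abstract \<open>\<Omega>\<close> such a kernel need not exist.\<close>

definition cond_prob_given ::
    "'w measure \<Rightarrow> 't measure \<Rightarrow> ('w \<Rightarrow> 't) \<Rightarrow> ('t \<Rightarrow> 'w measure) \<Rightarrow> bool" where
  "cond_prob_given M T \<Theta> Q \<longleftrightarrow>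
    Q \<in> T \<rightarrow>\<^sub>M prob_algebra M \<and>
    (\<forall>A\<in>sets M. AE \<omega> in M.
      measure (Q (\<Theta> \<omega>)) A = cond_prob_on M (gen_by M \<Theta> T) A \<omega>)"


section \<open>Parametrized models\<close>

definition exchangeable :: "'w measure \<Rightarrow> 'x measure \<Rightarrow> (nat \<Rightarrow> 'w \<Rightarrow> 'x) \<Rightarrow> bool" where
  "exchangeable M N Xs \<longleftrightarrow>
    (\<forall>n. Xs n \<in> M \<rightarrow>\<^sub>M N) \<and>
    (\<forall>\<pi>. bij \<pi> \<and> finite {n. \<pi> n \<noteq> n} \<longrightarrow>
      distr M (\<Pi>\<^sub>M n\<in>UNIV. N) (\<lambda>\<omega> n. Xs (\<pi> n) \<omega>) = distr M (\<Pi>\<^sub>M n\<in>UNIV. N) (\<lambda>\<omega> n. Xs n \<omega>))"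

text \<open>Weak convergence of the empirical measures of the sequence \<open>x\<close> to \<open>\<mu>\<close>.\<close>

definition empirical_limit :: "'x topology \<Rightarrow> (nat \<Rightarrow> 'x) \<Rightarrow> 'x measure \<Rightarrow> bool" where
  "empirical_limit X x \<mu> \<longleftrightarrow>
    (\<forall>h. continuous_map X euclideanreal h \<and> bounded (h ` topspace X) \<longrightarrow>
      (\<lambda>n. (\<Sum>i<n. h (x i)) / real n) \<longlonglongrightarrow> (\<integral>y. h y \<partial>\<mu>))"

text \<open>The sequences without limiting empirical measure form a null set for every exchangeable law
  (de Finetti); the values of \<open>F\<close> there are arbitrary, subject to measurability.\<close>

definition limiting_empirical_map :: "'x topology \<Rightarrow> ((nat \<Rightarrow> 'x) \<Rightarrow> 'x measure) \<Rightarrow> bool" where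
  "limiting_empirical_map X F \<longleftrightarrow>
    F \<in> (\<Pi>\<^sub>M n\<in>(UNIV :: nat set). borel_of X) \<rightarrow>\<^sub>M prob_algebra (borel_of X) \<and>
    (\<forall>x \<mu>. x \<in> UNIV \<rightarrow> topspace X \<and> \<mu> \<in> space (prob_algebra (borel_of X)) \<and> empirical_limit X x \<mu> \<longrightarrow>
      F x = \<mu>)"

definition bimeasurable_onto :: "'a measure \<Rightarrow> 'b measure \<Rightarrow> ('a \<Rightarrow> 'b) \<Rightarrow> bool" where
  "bimeasurable_onto M N \<psi> \<longleftrightarrow>
    \<psi> \<in> M \<rightarrow>\<^sub>M N \<and> (\<forall>A\<in>sets M. \<psi> ` A \<in> sets N) \<and> \<psi> ` space M = space N"

definition parametrized_model ::
    "'w measure \<Rightarrow> 'x topology \<Rightarrow> ('w \<Rightarrow> 'x) \<Rightarrow> 't measure \<Rightarrow> ('w \<Rightarrow> 't) \<Rightarrow> ('w \<Rightarrow> 'x measure) \<Rightarrow> bool" where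
  "parametrized_model M X\<^sub>t X T \<Theta> p \<longleftrightarrow>
    (\<exists>Xs F \<psi>.
      exchangeable M (borel_of X\<^sub>t) Xs \<and> X = Xs 0 \<and>
      limiting_empirical_map X\<^sub>t F \<and>
      bimeasurable_onto
        (restrict_space (prob_algebra (borel_of X\<^sub>t)) ((\<lambda>\<omega>. F (\<lambda>n. Xs n \<omega>)) ` space M)) T \<psi> \<and>
      (\<forall>\<omega>\<in>space M. \<Theta> \<omega> = \<psi> (F (\<lambda>n. Xs n \<omega>)))) \<and>
    regular_cond_law M (borel_of X\<^sub>t) X T \<Theta> p"

text \<open>A projective family of parametrized models with kernels \<open>P I = P\<^sub>I[X\<^sub>I|\<Theta>\<^sub>I]\<close>, and its
  projective limit kernel \<open>PD = P\<^sub>D[X\<^sub>D|\<Theta>\<^sub>D]\<close>.\<close>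

locale projective_limit_model =
  prob_space M + obs: projective_system D XS f + par: projective_system D TS g
  for M :: "'w measure" and D :: "'i::order set"
    and XS :: "'i \<Rightarrow> 'x topology" and f :: "'i \<Rightarrow> 'i \<Rightarrow> 'x \<Rightarrow> 'x"
    and TS :: "'i \<Rightarrow> 't topology" and g :: "'i \<Rightarrow> 'i \<Rightarrow> 't \<Rightarrow> 't" +
  fixes X :: "'i \<Rightarrow> 'w \<Rightarrow> 'x" and \<Theta> :: "'i \<Rightarrow> 'w \<Rightarrow> 't"
    and P :: "'i \<Rightarrow> 'w \<Rightarrow> 'x measure" and PD :: "'w \<Rightarrow> ('i \<Rightarrow> 'x) measure"
  assumes model: "\<And>I. I \<in> D \<Longrightarrow> parametrized_model M (XS I) (X I) (borel_of (TS I)) (\<Theta> I) (P I)"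
    and X_projective: "\<And>I J \<omega>. I \<in> D \<Longrightarrow> J \<in> D \<Longrightarrow> I \<le> J \<Longrightarrow> \<omega> \<in> space M \<Longrightarrow>
      X I \<omega> = f J I (X J \<omega>)"
    and \<Theta>_projective: "\<And>I J \<omega>. I \<in> D \<Longrightarrow> J \<in> D \<Longrightarrow> I \<le> J \<Longrightarrow> \<omega> \<in> space M \<Longrightarrow>
      \<Theta> I \<omega> = g J I (\<Theta> J \<omega>)"
    and P_projective: "\<And>I J. I \<in> D \<Longrightarrow> J \<in> D \<Longrightarrow> I \<le> J \<Longrightarrow>
      AE \<omega> in M. distr (P J \<omega>) (borel_of (XS I)) (f J I) = P I \<omega>"
    and PD_kernel: "PD \<in> gen_by M (proj_lim_var D \<Theta>) (proj_lim D TS g) \<rightarrow>\<^sub>M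
      prob_algebra (proj_lim D XS f)"
    and PD_limit: "\<And>I. I \<in> D \<Longrightarrow> AE \<omega> in M. distr (PD \<omega>) (borel_of (XS I)) (\<lambda>x. x I) = P I \<omega>"


section \<open>Sufficiency\<close>

text \<open>The notions below depend on \<open>P[X|\<Theta>]\<close> only through the variables \<open>X\<close> (in \<open>N\<close>) and \<open>\<Theta>\<close> (in \<open>T\<close>).
  The conditional probability \<open>P[B|\<Theta>,S]\<close> is that of \<open>X \<in> B\<close> given \<open>\<sigma>(\<Theta>) \<or> S\<close>.\<close>

definition sufficient ::
    "'w measure \<Rightarrow> 'x measure \<Rightarrow> ('w \<Rightarrow> 'x) \<Rightarrow> 't measure \<Rightarrow> ('w \<Rightarrow> 't) \<Rightarrow> 'w measure \<Rightarrow> bool" where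
  "sufficient M N X T \<Theta> S \<longleftrightarrow>
    subalgebra M S \<and>
    (\<exists>k \<in> M \<rightarrow>\<^sub>M prob_algebra M. \<forall>B\<in>sets N.
      (\<lambda>\<omega>. measure (k \<omega>) (X -` B \<inter> space M)) \<in> borel_measurable S \<and>
      (AE \<omega> in M.
        cond_prob_on M (sigma (space M) (sets (gen_by M \<Theta> T) \<union> sets S)) (X -` B \<inter> space M) \<omega>
          = measure (k \<omega>) (X -` B \<inter> space M)))"

text \<open>As \<open>P[ \<cdot> |\<Theta> = \<theta>]\<close> is determined only up to versions, \<open>P[A \<triangle> C|\<Theta> = \<theta>] = 0\<close> for all \<open>\<theta>\<close> is
  understood for some version of it. (For one fixed version, chosen arbitrarily on a null set of
  parameters, minimal sufficiency would depend on that choice.)\<close>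

definition minimal_sufficient ::
    "'w measure \<Rightarrow> 'x measure \<Rightarrow> ('w \<Rightarrow> 'x) \<Rightarrow> 't measure \<Rightarrow> ('w \<Rightarrow> 't) \<Rightarrow> 'w measure \<Rightarrow> bool" where
  "minimal_sufficient M N X T \<Theta> S \<longleftrightarrow>
    sufficient M N X T \<Theta> S \<and>
    (\<forall>\<C>. sufficient M N X T \<Theta> \<C> \<longrightarrow>
      (\<forall>A\<in>sets S. \<exists>C\<in>sets \<C>. \<exists>Q. cond_prob_given M T \<Theta> Q \<and>
        (\<forall>\<theta>\<in>space T. measure (Q \<theta>) (sym_diff A C) = 0)))"

end

theory Submission
  imports Defs
begin

text \<open>
  Write \<open>\<G>\<^sub>I\<close> and \<open>\<G>\<^sub>D\<close> for the \<open>\<sigma>\<close>-algebras generated by \<open>\<Theta> I\<close> and by the limit parameter, and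
  \<open>\<S>\<^sub>D\<close> for the \<open>\<sigma>\<close>-algebra generated by all \<open>S I\<close>.

  Minimality is inherited from the coordinates. A \<open>\<sigma>\<close>-algebra that is sufficient for the limit model
  is, with the same kernel, sufficient for each coordinate model, because both \<open>X I\<close> and \<open>\<Theta> I\<close>
  are functions of the limit variables (\<open>sufficient_coarser\<close>). Hence it contains each \<open>S I\<close> up to null
  sets, and the events that it contains up to null sets form a \<open>\<sigma>\<close>-algebra, so it contains \<open>\<S>\<^sub>D\<close> up to
  null sets. A null event is turned into one that is null for every parameter value by changing the
  conditional probability on a null set of parameters (\<open>cond_prob_given_vanishing_version\<close>).

  Sufficiency has two parts. The first is that the conditional probabilities are right. Since
  \<open>\<G>\<^sub>I\<close> is itself sufficient for the \<open>I\<close>-th model, minimality gives \<open>S I \<subseteq> \<G>\<^sub>I\<close> up to null sets, and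
  thus \<open>\<S>\<^sub>D \<subseteq> \<G>\<^sub>D\<close> up to null sets: conditioning on \<open>\<G>\<^sub>D\<close> together with \<open>\<S>\<^sub>D\<close> is
  conditioning on \<open>\<G>\<^sub>D\<close>. For an event \<open>A\<close> that depends on \<open>X I\<close> only, projectivity of the kernels says
  that conditioning \<open>A\<close> on \<open>\<G>\<^sub>K\<close> with \<open>K \<ge> I\<close> gives the same result as conditioning on \<open>\<G>\<^sub>I\<close>. The
  \<open>\<G>\<^sub>K\<close> form a directed family that generates \<open>\<G>\<^sub>D\<close>, so conditioning on \<open>\<G>\<^sub>D\<close> gives this result too, and
  sufficiency of \<open>S I\<close> provides an \<open>S I\<close>-measurable version of it
  (\<open>cylinder_cond_prob_disintegrates\<close>, \<open>cylinder_cond_prob_version\<close>).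

  The second part is to find one kernel \<open>k\<close> into the abstract space \<open>\<Omega>\<close> whose values on the events
  \<open>X \<in> B\<close> are exactly \<open>\<S>\<^sub>D\<close>-measurable. The given kernel \<open>Q\<close> composed with the limit parameter has the right
  values but is only \<open>\<G>\<^sub>D\<close>-measurable. It is averaged: \<open>k\<close> is the mixture of the \<open>Q \<theta>\<close> under the
  conditional distribution of the limit parameter given \<open>\<S>\<^sub>D\<close> (\<open>averaged_kernel\<close>). This leaves the
  conditional probabilities of cylinder events unchanged almost surely, as these have
  \<open>\<S>\<^sub>D\<close>-measurable versions already, and a Dynkin argument extends this to all events of the limit
  observation. Here the Polish parameter spaces enter: the projective limit of countably many
  Polish spaces is a measurable retract of the unit interval, where regular conditional distributions
  come from conditional distribution functions.
\<close>

section \<open>Conditional probabilities in integral form\<close>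

text \<open>The integral form of the statement that \<open>h\<close> is a conditional probability of \<open>A\<close>. Measurability of \<open>h\<close>
  is kept apart: one and the same \<open>h\<close> is tested against several families of events \<open>\<E>\<close>, for some of
  which it is not measurable.\<close>

definition disintegrates :: "'w measure \<Rightarrow> 'w set set \<Rightarrow> 'w set \<Rightarrow> ('w \<Rightarrow> real) \<Rightarrow> bool" where
  "disintegrates M \<E> A h \<longleftrightarrow> (\<forall>E\<in>\<E>. (\<integral>\<^sup>+\<omega>\<in>E. ennreal (h \<omega>) \<partial>M) = emeasure M (A \<inter> E))"

lemma disintegrates_subset: "disintegrates M \<E> A h \<Longrightarrow> \<E>' \<subseteq> \<E> \<Longrightarrow> disintegrates M \<E>' A h"
  by (auto simp: disintegrates_def)

lemma disintegrates_cong_AE: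
  assumes "AE \<omega> in M. h \<omega> = h' \<omega>"
  shows "disintegrates M \<E> A h \<longleftrightarrow> disintegrates M \<E> A h'"
proof -
  have "(\<integral>\<^sup>+\<omega>\<in>E. ennreal (h \<omega>) \<partial>M) = (\<integral>\<^sup>+\<omega>\<in>E. ennreal (h' \<omega>) \<partial>M)" for E
    by (rule nn_integral_cong_AE) (use assms in eventually_elim, simp)
  then show ?thesis by (simp add: disintegrates_def)
qed

lemma (in prob_space) cond_prob_on_nonneg:
  assumes "subalgebra M G" "A \<in> sets M"
  shows "AE \<omega> in M. 0 \<le> cond_prob_on M G A \<omega>"
proof -
  interpret finite_measure_subalgebra M G by unfold_locales (rule assms)
  show ?thesis unfolding cond_prob_on_def by (rule real_cond_exp_pos) (use assms in auto)
qed

lemma (in prob_space) cond_prob_on_disintegrates: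
  assumes sub: "subalgebra M G" and A: "A \<in> sets M"
  shows "disintegrates M (sets G) A (cond_prob_on M G A)"
  unfolding disintegrates_def
proof
  fix E assume E: "E \<in> sets G"
  interpret finite_measure_subalgebra M G by unfold_locales (rule sub)
  let ?F = "cond_prob_on M G A"
  have EM: "E \<in> sets M" using sub E by (auto simp: subalgebra_def)
  have A_int: "integrable M (indicat_real A)"
    by (intro integrable_real_indicator A) (simp add: less_top[symmetric])
  have int: "integrable M ?F" unfolding cond_prob_on_def by (rule real_cond_exp_int(1)[OF A_int])
  then have int': "integrable M (\<lambda>\<omega>. indicator E \<omega> * ?F \<omega>)"
    using integrable_mult_indicator[OF EM int] by simp
  have "(\<integral>\<^sup>+\<omega>\<in>E. ennreal (?F \<omega>) \<partial>M) = (\<integral>\<^sup>+\<omega>. ennreal (indicator E \<omega> * ?F \<omega>) \<partial>M)"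
    by (rule nn_integral_cong) (simp split: split_indicator)
  also have "\<dots> = ennreal (\<integral>\<omega>. indicator E \<omega> * ?F \<omega> \<partial>M)"
    by (rule nn_integral_eq_integral[OF int'])
       (use cond_prob_on_nonneg[OF sub A] in eventually_elim, auto)
  also have "(\<integral>\<omega>. indicator E \<omega> * ?F \<omega> \<partial>M) = (\<integral>\<omega>\<in>E. indicat_real A \<omega> \<partial>M)"
    using real_cond_exp_intA[OF A_int E] by (simp add: cond_prob_on_def set_lebesgue_integral_def)
  also have "\<dots> = measure M (A \<inter> E)"
    using A EM by (simp add: set_lebesgue_integral_def indicator_inter_arith[symmetric] Int_commute)
  finally show "(\<integral>\<^sup>+\<omega>\<in>E. ennreal (?F \<omega>) \<partial>M) = emeasure M (A \<inter> E)"
    by (simp add: emeasure_eq_measure)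
qed

text \<open>The converse of \<open>cond_prob_on_disintegrates\<close> for a measurable \<open>h\<close>: conditional expectations are
  characterized by their integrals.\<close>

lemma (in prob_space) AE_cond_prob_on_eqI:
  assumes sub: "subalgebra M G" and A: "A \<in> sets M"
    and h: "h \<in> borel_measurable G" and nonneg: "AE \<omega> in M. 0 \<le> h \<omega>"
    and dis: "disintegrates M (sets G) A h"
  shows "AE \<omega> in M. cond_prob_on M G A \<omega> = h \<omega>"
proof -
  interpret finite_measure_subalgebra M G by unfold_locales (rule sub)
  have hM: "h \<in> borel_measurable M" by (rule measurable_from_subalg[OF sub h])
  have A_int: "integrable M (indicat_real A)"
    by (intro integrable_real_indicator A) (simp add: less_top[symmetric])
  have h_int: "integrable M h"
  proof (rule integrableI_nonneg[OF hM nonneg])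
    have "space M \<in> sets G" using sub by (metis sets.top subalgebra_def)
    then have "(\<integral>\<^sup>+\<omega>\<in>space M. ennreal (h \<omega>) \<partial>M) = emeasure M (A \<inter> space M)"
      using dis by (auto simp: disintegrates_def)
    moreover have "(\<integral>\<^sup>+\<omega>\<in>space M. ennreal (h \<omega>) \<partial>M) = (\<integral>\<^sup>+\<omega>. ennreal (h \<omega>) \<partial>M)"
      by (rule nn_integral_cong) simp
    ultimately show "(\<integral>\<^sup>+\<omega>. ennreal (h \<omega>) \<partial>M) < \<infinity>" by (simp add: less_top[symmetric])
  qed
  show ?thesis unfolding cond_prob_on_def
  proof (rule real_cond_exp_charact[OF _ A_int h_int h])
    fix E assume E: "E \<in> sets G"
    have EM: "E \<in> sets M" using sub E by (auto simp: subalgebra_def)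
    have "ennreal (\<integral>\<omega>. indicator E \<omega> * h \<omega> \<partial>M) = (\<integral>\<^sup>+\<omega>. ennreal (indicator E \<omega> * h \<omega>) \<partial>M)"
      by (rule nn_integral_eq_integral[symmetric])
         (use integrable_mult_indicator[OF EM h_int] in simp, use nonneg in eventually_elim, auto)
    also have "\<dots> = (\<integral>\<^sup>+\<omega>\<in>E. ennreal (h \<omega>) \<partial>M)"
      by (rule nn_integral_cong) (simp split: split_indicator)
    also have "\<dots> = ennreal (measure M (A \<inter> E))"
      using dis E by (simp add: disintegrates_def emeasure_eq_measure)
    finally have "(\<integral>\<omega>. indicator E \<omega> * h \<omega> \<partial>M) = measure M (A \<inter> E)"
      by (subst (asm) ennreal_inj) (use nonneg in \<open>auto intro!: integral_nonneg_AE\<close>)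
    moreover have "(\<integral>\<omega>\<in>E. indicat_real A \<omega> \<partial>M) = measure M (A \<inter> E)"
      using A EM by (simp add: set_lebesgue_integral_def indicator_inter_arith[symmetric] Int_commute)
    ultimately show "(\<integral>\<omega>\<in>E. indicat_real A \<omega> \<partial>M) = (\<integral>\<omega>\<in>E. h \<omega> \<partial>M)"
      by (simp add: set_lebesgue_integral_def)
  qed
qed

text \<open>The uniqueness theorem for finite measures, for a \<open>\<sigma>\<close>-algebra that may be smaller than the one on
  which the measures live.\<close>

lemma emeasure_eq_on_sigma_sets:
  assumes stable: "Int_stable \<E>" and \<E>: "\<E> \<subseteq> sets \<mu>" and sets_eq: "sets \<mu>' = sets \<mu>"
    and fin: "finite_measure \<mu>" and space: "emeasure \<mu> (space \<mu>) = emeasure \<mu>' (space \<mu>)"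
    and eq: "\<And>E. E \<in> \<E> \<Longrightarrow> emeasure \<mu> E = emeasure \<mu>' E"
    and E: "E \<in> sigma_sets (space \<mu>) \<E>"
  shows "emeasure \<mu> E = emeasure \<mu>' E"
proof -
  have sp: "space \<mu>' = space \<mu>" by (rule sets_eq_imp_space_eq[OF sets_eq])
  have fin': "emeasure \<mu> A \<noteq> \<infinity>" for A using finite_measure.emeasure_finite[OF fin] by simp
  have gen: "sigma_sets (space \<mu>) \<E> \<subseteq> sets \<mu>" by (rule sets.sigma_sets_subset[OF \<E>])
  have "\<E> \<subseteq> Pow (space \<mu>)" using \<E> sets.sets_into_space by blast
  from stable this E show ?thesis
  proof (induction rule: sigma_sets_induct_disjoint)
    case (basic A) then show ?case by (rule eq)
  next
    case empty then show ?case by simp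
  next
    case (compl A)
    then have A: "A \<in> sets \<mu>" using gen by blast
    have "emeasure \<mu> (space \<mu> - A) = emeasure \<mu> (space \<mu>) - emeasure \<mu> A"
      by (rule emeasure_compl[OF A fin'])
    also have "\<dots> = emeasure \<mu>' (space \<mu>') - emeasure \<mu>' A"
      by (simp add: space sp compl.IH)
    also have "\<dots> = emeasure \<mu>' (space \<mu>' - A)"
      by (rule emeasure_compl[symmetric]) (use A sets_eq fin'[of A] compl.IH in auto)
    finally show ?case by (simp add: sp)
  next
    case (union A)
    then have A: "range A \<subseteq> sets \<mu>" using gen by blast
    have "emeasure \<mu> (\<Union>i. A i) = (\<Sum>i. emeasure \<mu> (A i))"
      by (rule suminf_emeasure[symmetric, OF A union(1)])
    also have "\<dots> = (\<Sum>i. emeasure \<mu>' (A i))" by (simp add: union.IH)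
    also have "\<dots> = emeasure \<mu>' (\<Union>i. A i)"
      by (rule suminf_emeasure[OF _ union(1)]) (use A sets_eq in simp)
    finally show ?case .
  qed
qed

text \<open>Both sides of the defining equation are finite measures in the test event, with densities \<open>h\<close> and the
  indicator of \<open>A\<close>.\<close>

lemma (in prob_space) disintegrates_sigma_sets:
  assumes stable: "Int_stable \<E>" and \<E>: "\<E> \<subseteq> sets M" "space M \<in> \<E>"
    and A: "A \<in> sets M" and h: "h \<in> borel_measurable M" and dis: "disintegrates M \<E> A h"
  shows "disintegrates M (sigma_sets (space M) \<E>) A h"
  unfolding disintegrates_def
proof
  fix E assume E: "E \<in> sigma_sets (space M) \<E>"
  let ?\<mu> = "density M (\<lambda>\<omega>. ennreal (h \<omega>))" and ?\<mu>' = "density M (indicator A)"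
  have 1: "emeasure ?\<mu> B = (\<integral>\<^sup>+\<omega>\<in>B. ennreal (h \<omega>) \<partial>M)" if "B \<in> sets M" for B
    using that h by (simp add: emeasure_density)
  have 2: "emeasure ?\<mu>' B = emeasure M (A \<inter> B)" if "B \<in> sets M" for B
    using that A by (simp add: emeasure_density indicator_inter_arith[symmetric])
  have eq: "emeasure ?\<mu> B = emeasure ?\<mu>' B" if "B \<in> \<E>" for B
    using that \<E>(1) dis 1[of B] 2[of B] unfolding disintegrates_def by auto
  have EM: "E \<in> sets M" using E sets.sigma_sets_subset[OF \<E>(1)] by blast
  have "emeasure ?\<mu> E = emeasure ?\<mu>' E"
  proof (rule emeasure_eq_on_sigma_sets[OF stable])
    show "finite_measure ?\<mu>"
      by (rule finite_measureI) (use eq[OF \<E>(2)] 2[of "space M"] in simp)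
    show "E \<in> sigma_sets (space ?\<mu>) \<E>" using E by simp
  qed (use \<E> eq in simp_all)
  then show "(\<integral>\<^sup>+\<omega>\<in>E. ennreal (h \<omega>) \<partial>M) = emeasure M (A \<inter> E)"
    using 1[OF EM] 2[OF EM] by simp
qed

section \<open>Events up to null sets\<close>

text \<open>The relation \<open>\<S> \<subseteq> null_closure M \<C>\<close> is the sense in which a minimal sufficient \<open>\<sigma>\<close>-algebra lies below
  every sufficient one.\<close>

definition null_closure :: "'w measure \<Rightarrow> 'w measure \<Rightarrow> 'w set set" where
  "null_closure M G = {A \<in> sets M. \<exists>C\<in>sets G. AE \<omega> in M. \<omega> \<in> A \<longleftrightarrow> \<omega> \<in> C}"

lemma null_closureI:
  assumes "A \<in> sets M" "C \<in> sets G" "AE \<omega> in M. \<omega> \<in> A \<longleftrightarrow> \<omega> \<in> C"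
  shows "A \<in> null_closure M G"
  using assms unfolding null_closure_def by blast

lemma sets_subset_null_closure: "subalgebra M G \<Longrightarrow> sets G \<subseteq> null_closure M G"
  by (auto simp: subalgebra_def intro: null_closureI)

lemma sigma_sets_subset_null_closure:
  assumes sub: "subalgebra M G" and \<E>: "\<E> \<subseteq> null_closure M G"
  shows "sigma_sets (space M) \<E> \<subseteq> null_closure M G"
proof
  fix A assume "A \<in> sigma_sets (space M) \<E>"
  then show "A \<in> null_closure M G"
  proof induction
    case (Basic A) then show ?case using \<E> by blast
  next
    case Empty show ?case by (rule null_closureI[of _ _ "{}"]) auto
  next
    case (Compl A)
    then obtain C where C: "A \<in> sets M" "C \<in> sets G" "AE \<omega> in M. \<omega> \<in> A \<longleftrightarrow> \<omega> \<in> C"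
      unfolding null_closure_def by blast
    show ?case
    proof (rule null_closureI)
      show "space M - A \<in> sets M" using C(1) by simp
      show "space M - C \<in> sets G" using C(2) sub by (metis sets.compl_sets subalgebra_def)
      show "AE \<omega> in M. \<omega> \<in> space M - A \<longleftrightarrow> \<omega> \<in> space M - C" using C(3) by eventually_elim simp
    qed
  next
    case (Union A)
    then have A: "A i \<in> sets M" and "\<exists>C. C \<in> sets G \<and> (AE \<omega> in M. \<omega> \<in> A i \<longleftrightarrow> \<omega> \<in> C)" for i
      unfolding null_closure_def by blast+
    then obtain C where C: "\<And>i. C i \<in> sets G" "\<And>i. AE \<omega> in M. \<omega> \<in> A i \<longleftrightarrow> \<omega> \<in> C i"
      by metis
    show ?case
    proof (rule null_closureI)
      show "(\<Union>i. A i) \<in> sets M" "(\<Union>i. C i) \<in> sets G" using A C(1) by blast+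
      have "AE \<omega> in M. \<forall>i. \<omega> \<in> A i \<longleftrightarrow> \<omega> \<in> C i" using C(2) by (simp add: AE_all_countable)
      then show "AE \<omega> in M. \<omega> \<in> (\<Union>i. A i) \<longleftrightarrow> \<omega> \<in> (\<Union>i. C i)" by eventually_elim simp
    qed
  qed
qed

text \<open>Enlarging the test events by null modifications is free. This is what allows conditioning on
  \<open>\<sigma>(\<Theta>) \<or> \<S>\<close> to be replaced by conditioning on \<open>\<sigma>(\<Theta>)\<close> when \<open>\<S>\<close> lies below \<open>\<sigma>(\<Theta>)\<close> up to null sets.\<close>

lemma disintegrates_null_closure:
  assumes sub: "subalgebra M G" and A: "A \<in> sets M" and dis: "disintegrates M (sets G) A h"
  shows "disintegrates M (null_closure M G) A h"
  unfolding disintegrates_def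
proof
  fix E assume "E \<in> null_closure M G"
  then obtain C where E: "E \<in> sets M" and C: "C \<in> sets G" "AE \<omega> in M. \<omega> \<in> E \<longleftrightarrow> \<omega> \<in> C"
    unfolding null_closure_def by blast
  have CM: "C \<in> sets M" using C(1) sub by (auto simp: subalgebra_def)
  have "(\<integral>\<^sup>+\<omega>\<in>E. ennreal (h \<omega>) \<partial>M) = (\<integral>\<^sup>+\<omega>\<in>C. ennreal (h \<omega>) \<partial>M)"
    by (rule nn_integral_cong_AE) (use C(2) in eventually_elim, simp split: split_indicator)
  also have "\<dots> = emeasure M (A \<inter> C)" using dis C(1) by (simp add: disintegrates_def)
  also have "\<dots> = emeasure M (A \<inter> E)"
    by (rule emeasure_eq_AE) (use C(2) in eventually_elim, use A E CM in auto)
  finally show "(\<integral>\<^sup>+\<omega>\<in>E. ennreal (h \<omega>) \<partial>M) = emeasure M (A \<inter> E)" .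
qed

lemma null_closure_mono: "sets G \<subseteq> sets G' \<Longrightarrow> null_closure M G \<subseteq> null_closure M G'"
  unfolding null_closure_def by blast

section \<open>Polish spaces as measurable retracts of an interval\<close>

text \<open>A measurable left inverse \<open>b\<close> of the code \<open>e\<close> suffices for transporting probability measures back from
  \<open>R\<close> to \<open>N\<close>. As \<open>b\<close> is defined on all of \<open>R\<close>, every measure on \<open>R\<close>
  can be decoded, whatever the range of \<open>e\<close> is.\<close>

definition measurable_retract :: "'a measure \<Rightarrow> 'b measure \<Rightarrow> bool" where
  "measurable_retract N R \<longleftrightarrow> (\<exists>e \<in> N \<rightarrow>\<^sub>M R. \<exists>b \<in> R \<rightarrow>\<^sub>M N. \<forall>x\<in>space N. b (e x) = x)"

lemma measurable_retractI:
  "e \<in> N \<rightarrow>\<^sub>M R \<Longrightarrow> b \<in> R \<rightarrow>\<^sub>M N \<Longrightarrow> (\<And>x. x \<in> space N \<Longrightarrow> b (e x) = x) \<Longrightarrow> measurable_retract N R"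
  unfolding measurable_retract_def by (intro bexI ballI)

lemma measurable_retractE:
  assumes "measurable_retract N R"
  obtains e b where "e \<in> N \<rightarrow>\<^sub>M R" "b \<in> R \<rightarrow>\<^sub>M N" "\<forall>x\<in>space N. b (e x) = x"
  using assms unfolding measurable_retract_def by (elim bexE)

lemma measurable_retract_trans:
  assumes "measurable_retract N R" "measurable_retract R S"
  shows "measurable_retract N S"
proof -
  obtain e b where 1: "e \<in> N \<rightarrow>\<^sub>M R" "b \<in> R \<rightarrow>\<^sub>M N" "\<forall>x\<in>space N. b (e x) = x"
    by (rule measurable_retractE[OF assms(1)])
  obtain e' b' where 2: "e' \<in> R \<rightarrow>\<^sub>M S" "b' \<in> S \<rightarrow>\<^sub>M R" "\<forall>x\<in>space R. b' (e' x) = x"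
    by (rule measurable_retractE[OF assms(2)])
  show ?thesis
  proof (rule measurable_retractI)
    show "(\<lambda>x. e' (e x)) \<in> N \<rightarrow>\<^sub>M S" by (rule measurable_compose[OF 1(1) 2(1)])
    show "(\<lambda>x. b (b' x)) \<in> S \<rightarrow>\<^sub>M N" by (rule measurable_compose[OF 2(2) 1(2)])
    show "b (b' (e' (e x))) = x" if "x \<in> space N" for x
      using that by (simp add: 1 2 measurable_space[OF 1(1)])
  qed
qed

definition baire_space :: "(nat \<Rightarrow> nat) measure" where
  "baire_space = (\<Pi>\<^sub>M n\<in>UNIV. count_space UNIV)"

lemma space_baire_space [simp]: "space baire_space = UNIV"
  by (simp add: baire_space_def space_PiM)

lemma measurable_baire_coordinate [measurable]: "(\<lambda>s. s n) \<in> baire_space \<rightarrow>\<^sub>M count_space UNIV"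
  unfolding baire_space_def by (rule measurable_component_singleton) simp

lemma measurable_baire_spaceI:
  assumes "\<And>n. (\<lambda>x. h x n) \<in> N \<rightarrow>\<^sub>M count_space UNIV"
  shows "h \<in> N \<rightarrow>\<^sub>M baire_space"
  unfolding baire_space_def using assms by (intro measurable_PiM_single') simp_all

lemma space_borel_of [simp]: "space (borel_of X) = topspace X"
  unfolding borel_of_def by (rule space_measure_of) (auto dest: openin_subset)

lemma sets_borel_of: "sets (borel_of X) = sigma_sets (topspace X) {U. openin X U}"
  unfolding borel_of_def by (rule sets_measure_of) (auto dest: openin_subset)

lemma openin_in_sets_borel_of: "openin X U \<Longrightarrow> U \<in> sets (borel_of X)"
  by (simp add: sets_borel_of sigma_sets.Basic)

lemma measurable_borel_ofI:
  assumes "h \<in> space N \<rightarrow> topspace X" "\<And>U. openin X U \<Longrightarrow> h -` U \<inter> space N \<in> sets N"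
  shows "h \<in> N \<rightarrow>\<^sub>M borel_of X"
  unfolding borel_of_def
proof (rule measurable_measure_of)
  show "{U. openin X U} \<subseteq> Pow (topspace X)" by (auto dest: openin_subset)
qed (use assms in simp_all)

lemma continuous_map_measurable_borel_of:
  assumes "continuous_map X Y h"
  shows "h \<in> borel_of X \<rightarrow>\<^sub>M borel_of Y"
proof (rule measurable_borel_ofI)
  show "h \<in> space (borel_of X) \<rightarrow> topspace Y"
    using assms by (auto simp: continuous_map_def)
  fix U assume "openin Y U"
  then have "openin X {x \<in> topspace X. h x \<in> U}"
    using assms by (auto simp: continuous_map_def)
  moreover have "h -` U \<inter> space (borel_of X) = {x \<in> topspace X. h x \<in> U}" by auto
  ultimately show "h -` U \<inter> space (borel_of X) \<in> sets (borel_of X)"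
    by (simp add: openin_in_sets_borel_of)
qed

text \<open>Every open set is the union of countably many balls with rational radius around points of the dense
  sequence.\<close>

lemma (in Metric_space) measurable_into_separable_mtopology:
  assumes dense: "\<And>y \<epsilon>. y \<in> M \<Longrightarrow> 0 < \<epsilon> \<Longrightarrow> \<exists>n::nat. d y (x n) < \<epsilon>" and x: "\<And>n. x n \<in> M"
    and h: "h \<in> space N \<rightarrow> M" and meas: "\<And>n. (\<lambda>s. d (x n) (h s)) \<in> borel_measurable N"
  shows "h \<in> N \<rightarrow>\<^sub>M borel_of mtopology"
proof (rule measurable_borel_ofI)
  show "h \<in> space N \<rightarrow> topspace mtopology" using h by simp
  fix U assume U: "openin mtopology U"
  let ?I = "{(n, q). q \<in> \<rat> \<and> mball (x n) q \<subseteq> U}"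
  have eq: "h -` U \<inter> space N = (\<Union>(n, q)\<in>?I. {s \<in> space N. d (x n) (h s) < q})"
  proof (intro equalityI subsetI)
    fix s assume s: "s \<in> h -` U \<inter> space N"
    then have hs: "h s \<in> M" "h s \<in> U" using h by auto
    then obtain r where r: "r > 0" "mball (h s) r \<subseteq> U"
      using U by (metis openin_mtopology)
    obtain q where q: "q \<in> \<rat>" "0 < q" "q < r / 2"
      using Rats_dense_in_real[of 0 "r / 2"] r by auto
    obtain n where n: "d (h s) (x n) < q" using dense[OF hs(1) q(2)] by auto
    have "mball (x n) q \<subseteq> mball (h s) r"
    proof
      fix z assume z: "z \<in> mball (x n) q"
      then have "d (h s) z \<le> d (h s) (x n) + d (x n) z"
        using hs x by (auto intro: triangle)
      then show "z \<in> mball (h s) r" using z n q hs by auto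
    qed
    then have "(n, q) \<in> ?I" using q r by auto
    moreover have "d (x n) (h s) < q" using n by (simp add: commute)
    ultimately show "s \<in> (\<Union>(n, q)\<in>?I. {s \<in> space N. d (x n) (h s) < q})"
      using s by blast
  next
    fix s assume "s \<in> (\<Union>(n, q)\<in>?I. {s \<in> space N. d (x n) (h s) < q})"
    then show "s \<in> h -` U \<inter> space N" using h x by (auto simp: in_mball subset_iff Pi_iff)
  qed
  have "?I \<subseteq> UNIV \<times> \<rat>" by auto
  then have "countable ?I"
    by (rule countable_subset) (auto intro: countable_rat)
  then show "h -` U \<inter> space N \<in> sets N"
    unfolding eq
  proof (rule sets.countable_UN'')
    fix i
    have "{s \<in> space N. d (x (fst i)) (h s) < snd i} \<in> sets N"
      using meas by (simp add: borel_measurable_iff_less)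
    then show "(case i of (n, q) \<Rightarrow> {s \<in> space N. d (x n) (h s) < q}) \<in> sets N"
      by (simp add: case_prod_beta)
  qed
qed

text \<open>The code of \<open>y\<close> is the sequence of indices \<open>s m\<close> of the first points \<open>x (s m)\<close> of the dense sequence
  within distance \<open>2\<^sup>-\<^sup>m\<close> of \<open>y\<close>, and decoding takes the limit. The limit is defined on a measurable set of
  sequences that contains all codes, and it is measurable because distances to it are limits of
  distances.\<close>

lemma (in Metric_space) measurable_retract_baire_space:
  assumes complete: "mcomplete"
    and dense: "\<And>y \<epsilon>. y \<in> M \<Longrightarrow> 0 < \<epsilon> \<Longrightarrow> \<exists>n::nat. d y (x n) < \<epsilon>" and x: "\<And>n. x n \<in> M"
  shows "measurable_retract (borel_of mtopology) baire_space"
proof -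
  define e where "e y m = (LEAST n. d y (x n) < (1/2) ^ m)" for y and m :: nat
  \<comment> \<open>A countable condition that holds for every code and forces the Cauchy property.\<close>
  define good where "good s \<longleftrightarrow> (\<forall>m m'. d (x (s m)) (x (s m')) < (1/2) ^ m + (1/2) ^ m')"
    for s :: "nat \<Rightarrow> nat"
  define b where "b s = (if good s then SOME l. limitin mtopology (\<lambda>m. x (s m)) l sequentially else x 0)"
    for s
  have e: "d y (x (e y m)) < (1/2) ^ m" if "y \<in> M" for y m
    unfolding e_def using dense[OF that, of "(1/2) ^ m"] by (auto intro: LeastI)
  have b_lim: "limitin mtopology (\<lambda>m. x (s m)) (b s) sequentially" if "good s" for s
  proof -
    have "MCauchy (\<lambda>m. x (s m))"
      unfolding MCauchy_def
    proof (intro conjI allI impI)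
      show "range (\<lambda>m. x (s m)) \<subseteq> M" using x by auto
      fix \<epsilon> :: real assume "\<epsilon> > 0"
      then obtain N where N: "(1/2) ^ N < \<epsilon> / 2"
        using real_arch_pow_inv[of "\<epsilon>/2" "1/2"] by auto
      have "d (x (s n)) (x (s n')) < \<epsilon>" if "N \<le> n" "N \<le> n'" for n n'
      proof -
        have "(1/2::real) ^ n \<le> (1/2) ^ N" "(1/2::real) ^ n' \<le> (1/2) ^ N"
          using that by (auto intro: power_decreasing)
        moreover have "d (x (s n)) (x (s n')) < (1/2) ^ n + (1/2) ^ n'"
          using \<open>good s\<close> by (auto simp: good_def)
        ultimately show ?thesis using N by linarith
      qed
      then show "\<exists>N. \<forall>n n'. N \<le> n \<longrightarrow> N \<le> n' \<longrightarrow> d (x (s n)) (x (s n')) < \<epsilon>" by blast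
    qed
    then have "\<exists>l. limitin mtopology (\<lambda>m. x (s m)) l sequentially"
      using complete by (auto simp: mcomplete_def)
    then show ?thesis using that by (auto simp: b_def intro: someI_ex)
  qed
  have b_M: "b s \<in> M" for s
  proof (cases "good s")
    case True
    then show ?thesis using b_lim[of s] by (simp add: limitin_metric)
  next
    case False
    then show ?thesis using x by (simp add: b_def)
  qed
  have [measurable]: "Measurable.pred baire_space good"
    unfolding good_def by measurable
  have [measurable]: "(\<lambda>y. d y (x n)) \<in> borel_measurable (borel_of mtopology)" for n
  proof (subst borel_measurable_iff_less, intro allI)
    fix a
    have "{w \<in> space (borel_of mtopology). d w (x n) < a} = mball (x n) a"
      using x by (auto simp: commute)
    then show "{w \<in> space (borel_of mtopology). d w (x n) < a} \<in> sets (borel_of mtopology)"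
      by (simp add: openin_in_sets_borel_of)
  qed
  have "e \<in> borel_of mtopology \<rightarrow>\<^sub>M baire_space"
    by (rule measurable_baire_spaceI) (unfold e_def, measurable)
  moreover have "b \<in> baire_space \<rightarrow>\<^sub>M borel_of mtopology"
  proof (rule measurable_into_separable_mtopology[OF dense x])
    show "b \<in> space baire_space \<rightarrow> M" using b_M by auto
    fix n
    have "d (x n) (b s) = (if good s then lim (\<lambda>m. d (x n) (x (s m))) else d (x n) (x 0))" for s
    proof (cases "good s")
      case True
      have "(\<lambda>m. d (x (s m)) (b s)) \<longlonglongrightarrow> 0"
        using b_lim[OF True] by (simp add: limitin_metric_dist_null)
      then have "(\<lambda>m. d (x n) (x (s m))) \<longlonglongrightarrow> d (x n) (b s)"
      proof (rule metric_tendsto_imp_tendsto, intro always_eventually allI)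
        fix m
        show "dist (d (x n) (x (s m))) (d (x n) (b s)) \<le> dist (d (x (s m)) (b s)) 0"
          using mdist_reverse_triangle[of "x (s m)" "b s" "x n"] triangle[of "x n" "x (s m)" "b s"]
            triangle[of "x n" "b s" "x (s m)"] x b_M
          by (auto simp: dist_real_def commute abs_le_iff)
      qed
      then show ?thesis using True by (simp add: limI)
    qed (simp add: b_def)
    then show "(\<lambda>s. d (x n) (b s)) \<in> borel_measurable baire_space"
      by simp
  qed auto
  moreover have "b (e y) = y" if y: "y \<in> M" for y
  proof -
    have "good (e y)" unfolding good_def
    proof (intro allI)
      fix m m'
      have "d (x (e y m)) (x (e y m')) \<le> d (x (e y m)) y + d y (x (e y m'))"
        using x y by (auto intro: triangle)
      then show "d (x (e y m)) (x (e y m')) < (1/2) ^ m + (1/2) ^ m'"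
        using e[OF y, of m] e[OF y, of m'] by (simp add: commute)
    qed
    moreover have "limitin mtopology (\<lambda>m. x (e y m)) y sequentially"
      unfolding limitin_metric_dist_null
    proof (intro conjI)
      have "(\<lambda>m. (1/2::real) ^ m) \<longlonglongrightarrow> 0" by (rule LIMSEQ_realpow_zero) auto
      then show "(\<lambda>m. d (x (e y m)) y) \<longlonglongrightarrow> 0"
        by (rule Lim_null_comparison[rotated])
           (use e[OF y] in \<open>auto simp: commute intro!: always_eventually less_imp_le\<close>)
    qed (use x y in auto)
    ultimately show ?thesis
      using b_lim[of "e y"] limitin_metric_unique[of "\<lambda>m. x (e y m)" "b (e y)" sequentially y] by simp
  qed
  ultimately show ?thesis by (auto intro: measurable_retractI)
qed

lemma polish_space_measurable_retract:
  assumes "polish_space X" "topspace X \<noteq> {}"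
  shows "measurable_retract (borel_of X) baire_space"
proof -
  obtain M d where "Metric_space M d" and mc: "Metric_space.mcomplete M d"
    and X: "X = Metric_space.mtopology M d"
    using assms by (auto simp: polish_space_def completely_metrizable_space_def)
  then interpret Metric_space M d by simp
  obtain C where C: "countable C" "C \<subseteq> M" "mtopology closure_of C = M"
    using assms by (auto simp: polish_space_def separable_space_def X)
  have "C \<noteq> {}" using C assms X by auto
  show ?thesis unfolding X
  proof (rule measurable_retract_baire_space[OF mc])
    show "from_nat_into C n \<in> M" for n
      using from_nat_into[OF \<open>C \<noteq> {}\<close>, of n] C by auto
    fix y \<epsilon> assume "y \<in> M" "0 < (\<epsilon>::real)"
    then have "\<exists>c\<in>C. d y c < \<epsilon>"
      using C(3) unfolding metric_closure_of in_mball by blast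
    then show "\<exists>n. d y (from_nat_into C n) < \<epsilon>"
      by (metis C(1) from_nat_into_surj)
  qed
qed

text \<open>Base 4 with the digits 0 and 1 only: the tail of the expansion stays below one unit of the last
  digit read, so that the digits can be recovered from integer parts without any exception for
  ambiguous expansions.\<close>

definition digit_sum :: "(nat \<Rightarrow> bool) \<Rightarrow> real" where
  "digit_sum \<beta> = (\<Sum>i. of_bool (\<beta> i) * (1/4) ^ Suc i)"

lemma digit_sum_summable: "summable (\<lambda>i. of_bool (\<beta> i) * (1/4::real) ^ Suc i)"
  by (rule summable_comparison_test'[of "\<lambda>i. (1/4::real) ^ i" 0]) (auto simp: summable_geometric)

lemma digit_sum_bounds: "0 \<le> digit_sum \<beta>" "digit_sum \<beta> < 1"
proof -
  show "0 \<le> digit_sum \<beta>" unfolding digit_sum_def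
    by (rule suminf_nonneg[OF digit_sum_summable]) auto
  have s: "(\<lambda>i. (1/4::real) * (1/4) ^ i) sums (1/4 * (1 / (1 - 1/4)))"
    by (intro sums_mult geometric_sums) auto
  have "digit_sum \<beta> \<le> (\<Sum>i. (1/4::real) * (1/4) ^ i)" unfolding digit_sum_def
    by (rule suminf_le[OF _ digit_sum_summable sums_summable[OF s]]) auto
  then show "digit_sum \<beta> < 1" using sums_unique[OF s] by simp
qed

lemma digit_sum_digit: "odd \<lfloor>4 ^ Suc i * digit_sum \<beta>\<rfloor> \<longleftrightarrow> \<beta> i"
proof -
  \<comment> \<open>The integer part splits into the last digit and the even contribution \<open>h\<close> of the earlier ones.\<close>
  define h :: int where "h = (\<Sum>j<i. of_bool (\<beta> j) * 4 ^ (i - j))"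
  let ?t = "\<lambda>j. of_bool (\<beta> j) * (1/4::real) ^ Suc j"
  have "digit_sum \<beta> = (\<Sum>j. ?t (j + Suc i)) + (\<Sum>j<Suc i. ?t j)"
    unfolding digit_sum_def by (rule suminf_split_initial_segment[OF digit_sum_summable])
  also have "(\<Sum>j. ?t (j + Suc i)) = (\<Sum>j. (1/4) ^ Suc i * (of_bool (\<beta> (j + Suc i)) * (1/4) ^ Suc j))"
    by (simp add: power_add mult_ac)
  also have "\<dots> = (1/4) ^ Suc i * digit_sum (\<lambda>j. \<beta> (j + Suc i))"
    unfolding digit_sum_def by (rule suminf_mult[OF digit_sum_summable])
  finally have "4 ^ Suc i * digit_sum \<beta>
      = digit_sum (\<lambda>j. \<beta> (j + Suc i)) + 4 ^ Suc i * (\<Sum>j<Suc i. ?t j)"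
    by (simp add: algebra_simps power_one_over)
  also have "4 ^ Suc i * (\<Sum>j<Suc i. ?t j) = (\<Sum>j<Suc i. of_bool (\<beta> j) * 4 ^ (i - j))"
    unfolding sum_distrib_left
    by (rule sum.cong) (auto simp: power_diff power_one_over)
  also have "\<dots> = of_int (h + of_bool (\<beta> i))"
    by (simp add: h_def)
  finally have "\<lfloor>4 ^ Suc i * digit_sum \<beta>\<rfloor> = h + of_bool (\<beta> i)"
    using digit_sum_bounds[of "\<lambda>j. \<beta> (j + Suc i)"] by (intro floor_unique) auto
  moreover have "even h"
    unfolding h_def by (rule dvd_sum) auto
  ultimately show ?thesis by simp
qed

text \<open>A sequence of natural numbers is coded by the graph relation \<open>s m = n\<close>, read as a sequence of bits
  along the enumeration of all pairs.\<close>

lemma baire_space_measurable_retract: "measurable_retract baire_space (restrict_space borel {0..1::real})"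
proof -
  define e where "e s = digit_sum (\<lambda>i. s (fst (prod_decode i)) = snd (prod_decode i))"
    for s :: "nat \<Rightarrow> nat"
  define b where "b z m = (LEAST n. odd \<lfloor>4 ^ Suc (prod_encode (m, n)) * z\<rfloor>)" for z :: real and m
  have "e \<in> baire_space \<rightarrow>\<^sub>M restrict_space borel {0..1}"
  proof (rule measurable_restrict_space2)
    show "e \<in> space baire_space \<rightarrow> {0..1}"
      using digit_sum_bounds by (simp add: e_def less_imp_le)
    have "(\<lambda>s. of_bool (s m = n) * (c::real)) \<in> borel_measurable baire_space" for m n c
      by (rule measurable_compose[OF measurable_baire_coordinate[of m]]) simp
    then show "e \<in> borel_measurable baire_space"
      unfolding e_def digit_sum_def by (rule borel_measurable_suminf)
  qed
  moreover have "b \<in> borel \<rightarrow>\<^sub>M baire_space"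
  proof (rule measurable_baire_spaceI)
    fix m
    have "(\<lambda>z::real. \<lfloor>4 ^ Suc (prod_encode (m, n)) * z\<rfloor>) \<in> borel \<rightarrow>\<^sub>M count_space UNIV" for n
      by (rule measurable_compose[OF _ measurable_real_floor]) simp
    then have "Measurable.pred borel (\<lambda>z::real. odd \<lfloor>4 ^ Suc (prod_encode (m, n)) * z\<rfloor>)" for n
      by (rule measurable_compose) simp
    then show "(\<lambda>z. b z m) \<in> borel \<rightarrow>\<^sub>M count_space UNIV"
      unfolding b_def by (rule measurable_Least)
  qed
  then have "b \<in> restrict_space borel {0..1} \<rightarrow>\<^sub>M baire_space"
    by (rule measurable_restrict_space1)
  moreover have "b (e s) = s" for s
  proof
    fix m
    have "b (e s) m = (LEAST n. s m = n)"
      by (simp only: b_def e_def digit_sum_digit prod_encode_inverse fst_conv snd_conv)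
    also have "\<dots> = s m" by (rule Least_equality) auto
    finally show "b (e s) m = s m" .
  qed
  ultimately show ?thesis by (auto intro: measurable_retractI)
qed

section \<open>Projective limits\<close>

lemma space_proj_lim [simp]: "space (proj_lim D X f) = proj_lim_set D X f"
  unfolding proj_lim_def by (rule space_measure_of) blast

lemma sets_proj_lim: "sets (proj_lim D X f) = sigma_sets (proj_lim_set D X f)
    {(\<lambda>x. x I) -` B \<inter> proj_lim_set D X f | I B. I \<in> D \<and> B \<in> sets (borel_of (X I))}"
  unfolding proj_lim_def by (rule sets_measure_of) blast

lemma proj_lim_setD: "x \<in> proj_lim_set D X f \<Longrightarrow> I \<in> D \<Longrightarrow> x I \<in> topspace (X I)"
  unfolding proj_lim_set_def by (blast dest: PiE_mem)

lemma measurable_proj_lim_coordinate: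
  assumes "I \<in> D"
  shows "(\<lambda>x. x I) \<in> proj_lim D X f \<rightarrow>\<^sub>M borel_of (X I)"
proof (rule measurableI)
  show "(\<lambda>x. x I) x \<in> space (borel_of (X I))" if "x \<in> space (proj_lim D X f)" for x
    using proj_lim_setD[OF _ assms] that by simp
  show "(\<lambda>x. x I) -` B \<inter> space (proj_lim D X f) \<in> sets (proj_lim D X f)"
    if "B \<in> sets (borel_of (X I))" for B
    unfolding sets_proj_lim space_proj_lim by (rule sigma_sets.Basic) (use that assms in blast)
qed

lemma measurable_proj_limI:
  assumes h: "h \<in> space N \<rightarrow> proj_lim_set D X f"
    and meas: "\<And>I. I \<in> D \<Longrightarrow> (\<lambda>s. h s I) \<in> N \<rightarrow>\<^sub>M borel_of (X I)"
  shows "h \<in> N \<rightarrow>\<^sub>M proj_lim D X f"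
proof -
  let ?G = "{(\<lambda>x. x I) -` B \<inter> proj_lim_set D X f | I B. I \<in> D \<and> B \<in> sets (borel_of (X I))}"
  have "h -` A \<inter> space N \<in> sets N" if "A \<in> ?G" for A
  proof -
    from that obtain I B where A: "A = (\<lambda>x. x I) -` B \<inter> proj_lim_set D X f"
      and IB: "I \<in> D" "B \<in> sets (borel_of (X I))" by blast
    have "h -` A \<inter> space N = (\<lambda>s. h s I) -` B \<inter> space N"
      using h A by auto
    then show ?thesis
      using measurable_sets[OF meas[OF IB(1)] IB(2)] by simp
  qed
  moreover have "?G \<subseteq> Pow (proj_lim_set D X f)" by blast
  ultimately show ?thesis
    unfolding proj_lim_def by (intro measurable_measure_of h)
qed

lemma (in projective_system) proj_lim_var_measurable:
  assumes V: "\<And>I. I \<in> D \<Longrightarrow> V I \<in> M \<rightarrow>\<^sub>M borel_of (X I)"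
    and proj: "\<And>I J \<omega>. I \<in> D \<Longrightarrow> J \<in> D \<Longrightarrow> I \<le> J \<Longrightarrow> \<omega> \<in> space M \<Longrightarrow> V I \<omega> = f J I (V J \<omega>)"
  shows "proj_lim_var D V \<in> M \<rightarrow>\<^sub>M proj_lim D X f"
proof (rule measurable_proj_limI)
  show "proj_lim_var D V \<in> space M \<rightarrow> proj_lim_set D X f"
  proof
    fix \<omega> assume \<omega>: "\<omega> \<in> space M"
    show "proj_lim_var D V \<omega> \<in> proj_lim_set D X f"
      unfolding proj_lim_set_def
    proof (intro CollectI conjI ballI impI)
      show "proj_lim_var D V \<omega> \<in> (\<Pi>\<^sub>E I\<in>D. topspace (X I))"
        using measurable_space[OF V \<omega>] by (simp add: proj_lim_var_def)
      fix I J assume IJ: "I \<in> D" "J \<in> D" "I \<le> J"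
      show "proj_lim_var D V \<omega> I = f J I (proj_lim_var D V \<omega> J)"
        unfolding proj_lim_var_def restrict_apply'[OF IJ(1)] restrict_apply'[OF IJ(2)]
        by (rule proj[OF IJ \<omega>])
    qed
  qed
  show "(\<lambda>\<omega>. proj_lim_var D V \<omega> I) \<in> M \<rightarrow>\<^sub>M borel_of (X I)" if "I \<in> D" for I
    using V[OF that] that by (simp add: proj_lim_var_def)
qed

lemma proj_lim_var_vimage:
  assumes "I \<in> D" "proj_lim_var D V \<in> M \<rightarrow>\<^sub>M proj_lim D X f"
  shows "proj_lim_var D V -` ((\<lambda>x. x I) -` B \<inter> proj_lim_set D X f) \<inter> space M = V I -` B \<inter> space M"
proof -
  have "proj_lim_var D V \<omega> I = V I \<omega>" for \<omega> using assms(1) by (simp add: proj_lim_var_def)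
  moreover have "proj_lim_var D V \<omega> \<in> proj_lim_set D X f" if "\<omega> \<in> space M" for \<omega>
    using measurable_space[OF assms(2) that] by simp
  ultimately show ?thesis by auto
qed

text \<open>Two cylinders are cylinders over a common upper bound of their indices.\<close>

lemma (in projective_system) Int_stable_cylinders:
  "Int_stable {(\<lambda>x. x I) -` B \<inter> proj_lim_set D X f | I B. I \<in> D \<and> B \<in> sets (borel_of (X I))}"
    (is "Int_stable ?\<C>")
proof (rule Int_stableI)
  fix a b assume "a \<in> ?\<C>" "b \<in> ?\<C>"
  then obtain I B J C where I: "I \<in> D" "B \<in> sets (borel_of (X I))"
    and J: "J \<in> D" "C \<in> sets (borel_of (X J))"
    and a: "a = (\<lambda>x. x I) -` B \<inter> proj_lim_set D X f" and b: "b = (\<lambda>x. x J) -` C \<inter> proj_lim_set D X f"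
    by blast
  obtain K where K: "K \<in> D" "I \<le> K" "J \<le> K" using D_directed[OF I(1) J(1)] by blast
  let ?B = "f K I -` B \<inter> topspace (X K)" and ?C = "f K J -` C \<inter> topspace (X K)"
  have "?B \<in> sets (borel_of (X K))"
    using measurable_sets[OF continuous_map_measurable_borel_of[OF f_continuous[OF I(1) K(1,2)]] I(2)]
    by simp
  moreover have "?C \<in> sets (borel_of (X K))"
    using measurable_sets[OF continuous_map_measurable_borel_of[OF f_continuous[OF J(1) K(1,3)]] J(2)]
    by simp
  ultimately have "?B \<inter> ?C \<in> sets (borel_of (X K))" by (rule sets.Int)
  moreover have "x I = f K I (x K)" "x J = f K J (x K)" "x K \<in> topspace (X K)"
    if "x \<in> proj_lim_set D X f" for x
    using that I(1) J(1) K proj_lim_setD[OF that K(1)] unfolding proj_lim_set_def by blast+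
  then have "a \<inter> b = (\<lambda>x. x K) -` (?B \<inter> ?C) \<inter> proj_lim_set D X f"
    unfolding a b by auto
  ultimately show "a \<inter> b \<in> ?\<C>" using K(1) by blast
qed

text \<open>Countably many codes are interleaved into one. A decoded family need not be consistent with the
  maps \<open>f J I\<close>, but consistency is a countable conjunction of equations, each of which can be tested on
  codes; inconsistent families are sent to one chosen point of the limit.\<close>

lemma (in projective_system) proj_lim_measurable_retract:
  assumes "proj_lim_set D X f \<noteq> {}"
  shows "measurable_retract (proj_lim D X f) baire_space"
proof -
  obtain x0 where x0: "x0 \<in> proj_lim_set D X f" using assms by auto
  have "\<exists>e b. e \<in> borel_of (X I) \<rightarrow>\<^sub>M baire_space \<and> b \<in> baire_space \<rightarrow>\<^sub>M borel_of (X I) \<and>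
      (\<forall>x\<in>topspace (X I). b (e x) = x)" if I: "I \<in> D" for I
  proof -
    have "measurable_retract (borel_of (X I)) baire_space"
      using polish_space_measurable_retract[OF polish[OF I]] proj_lim_setD[OF x0 I] by blast
    then obtain e b where "e \<in> borel_of (X I) \<rightarrow>\<^sub>M baire_space" "b \<in> baire_space \<rightarrow>\<^sub>M borel_of (X I)"
        "\<forall>x\<in>space (borel_of (X I)). b (e x) = x" by (rule measurable_retractE)
    then show ?thesis unfolding space_borel_of by (intro exI conjI)
  qed
  then obtain e b where e: "\<And>I. I \<in> D \<Longrightarrow> e I \<in> borel_of (X I) \<rightarrow>\<^sub>M baire_space"
    and b: "\<And>I. I \<in> D \<Longrightarrow> b I \<in> baire_space \<rightarrow>\<^sub>M borel_of (X I)"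
    and be: "\<And>I x. I \<in> D \<Longrightarrow> x \<in> topspace (X I) \<Longrightarrow> b I (e I x) = x"
    by metis
  have e_inj: "x = y \<longleftrightarrow> (\<forall>m. e I x m = e I y m)"
    if "I \<in> D" "x \<in> topspace (X I)" "y \<in> topspace (X I)" for I x y
    using be[OF that(1,2)] be[OF that(1,3)] by (metis ext)
  define ix where "ix k = from_nat_into D (fst (prod_decode k))" for k
  have ix: "ix k \<in> D" for k unfolding ix_def by (rule from_nat_into[OF D_nonempty])
  define E where "E x k = e (ix k) (x (ix k)) (snd (prod_decode k))" for x k
  define dec where "dec s I = b I (\<lambda>j. s (prod_encode (to_nat_on D I, j)))" for s I
  define good where "good s \<longleftrightarrow> (\<forall>I\<in>D. \<forall>J\<in>D. I \<le> J \<longrightarrow> dec s I = f J I (dec s J))" for s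
  define B where "B s = (if good s then \<lambda>I\<in>D. dec s I else x0)" for s
  have dec: "(\<lambda>s. dec s I) \<in> baire_space \<rightarrow>\<^sub>M borel_of (X I)" if "I \<in> D" for I
    unfolding dec_def
    by (rule measurable_compose[OF measurable_baire_spaceI b[OF that]])
       (rule measurable_baire_coordinate)
  have dec_top: "dec s I \<in> topspace (X I)" if "I \<in> D" for s I
    using measurable_space[OF dec[OF that], of s] by simp
  have f_meas: "f J I \<in> borel_of (X J) \<rightarrow>\<^sub>M borel_of (X I)" if "I \<in> D" "J \<in> D" "I \<le> J" for I J
    by (rule continuous_map_measurable_borel_of[OF f_continuous[OF that]])
  have good_meas: "Measurable.pred baire_space good"
    unfolding good_def
    unfolding pred_def
  proof (intro sets.sets_Collect_countable_All' D_countable, unfold pred_def[symmetric],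
      rule pred_intros_imp')
    fix I J assume IJ: "I \<in> D" "J \<in> D" "I \<le> J"
    have 1 [measurable]: "(\<lambda>s. e I (dec s I) m) \<in> baire_space \<rightarrow>\<^sub>M count_space UNIV" for m
      by (rule measurable_compose[OF dec[OF IJ(1)]
            measurable_compose[OF e[OF IJ(1)] measurable_baire_coordinate]])
    have 2 [measurable]: "(\<lambda>s. e I (f J I (dec s J)) m) \<in> baire_space \<rightarrow>\<^sub>M count_space UNIV" for m
      by (rule measurable_compose[OF measurable_compose[OF dec[OF IJ(2)] f_meas[OF IJ]]
            measurable_compose[OF e[OF IJ(1)] measurable_baire_coordinate]])
    have "f J I (dec s J) \<in> topspace (X I)" for s
      using measurable_space[OF f_meas[OF IJ]] dec_top[OF IJ(2)] by simp
    then have "dec s I = f J I (dec s J) \<longleftrightarrow> (\<forall>m. e I (dec s I) m = e I (f J I (dec s J)) m)" for s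
      by (intro e_inj IJ dec_top)
    moreover have "Measurable.pred baire_space (\<lambda>s. \<forall>m. e I (dec s I) m = e I (f J I (dec s J)) m)"
      by measurable
    ultimately show "Measurable.pred baire_space (\<lambda>s. dec s I = f J I (dec s J))"
      by simp
  qed
  show ?thesis
  proof (rule measurable_retractI)
    show "E \<in> proj_lim D X f \<rightarrow>\<^sub>M baire_space"
    proof (rule measurable_baire_spaceI)
      fix k
      show "(\<lambda>x. E x k) \<in> proj_lim D X f \<rightarrow>\<^sub>M count_space UNIV"
        unfolding E_def
      proof (rule measurable_compose[where g = "\<lambda>y. e (ix k) y (snd (prod_decode k))"])
        show "(\<lambda>x. x (ix k)) \<in> proj_lim D X f \<rightarrow>\<^sub>M borel_of (X (ix k))"
          by (rule measurable_proj_lim_coordinate[OF ix])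
        show "(\<lambda>y. e (ix k) y (snd (prod_decode k))) \<in> borel_of (X (ix k)) \<rightarrow>\<^sub>M count_space UNIV"
          by (rule measurable_compose[OF e[OF ix] measurable_baire_coordinate])
      qed
    qed
    show "B \<in> baire_space \<rightarrow>\<^sub>M proj_lim D X f"
    proof (rule measurable_proj_limI)
      have "(\<lambda>I\<in>D. dec s I) \<in> proj_lim_set D X f" if "good s" for s
        unfolding proj_lim_set_def
      proof (intro CollectI conjI ballI impI)
        show "(\<lambda>I\<in>D. dec s I) \<in> (\<Pi>\<^sub>E I\<in>D. topspace (X I))"
          using dec_top by simp
        fix I J assume IJ: "I \<in> D" "J \<in> D" "I \<le> J"
        have "dec s I = f J I (dec s J)"
          using that IJ unfolding good_def by blast
        then show "(\<lambda>I\<in>D. dec s I) I = f J I ((\<lambda>I\<in>D. dec s I) J)"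
          by (simp only: restrict_apply' IJ)
      qed
      then show "B \<in> space baire_space \<rightarrow> proj_lim_set D X f"
        using x0 by (simp add: B_def)
      fix I assume I: "I \<in> D"
      have "(\<lambda>s. B s I) = (\<lambda>s. if good s then dec s I else x0 I)"
        using I by (auto simp: B_def)
      also have "\<dots> \<in> baire_space \<rightarrow>\<^sub>M borel_of (X I)"
        by (rule measurable_If) (use dec[OF I] proj_lim_setD[OF x0 I] good_meas in \<open>simp_all add: pred_def\<close>)
      finally show "(\<lambda>s. B s I) \<in> baire_space \<rightarrow>\<^sub>M borel_of (X I)" .
    qed
    fix x assume x: "x \<in> space (proj_lim D X f)"
    have dE: "dec (E x) I = x I" if "I \<in> D" for I
    proof -
      have "(\<lambda>j. E x (prod_encode (to_nat_on D I, j))) = e I (x I)"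
        using that D_countable by (simp add: E_def ix_def fun_eq_iff)
      then show ?thesis
        using be[OF that proj_lim_setD[OF x[unfolded space_proj_lim] that]] by (simp add: dec_def)
    qed
    have "x I = f J I (x J)" if "I \<in> D" "J \<in> D" "I \<le> J" for I J
      using x that unfolding space_proj_lim proj_lim_set_def by blast
    then have "good (E x)"
      unfolding good_def by (metis dE)
    then have "B (E x) = (\<lambda>I\<in>D. x I)"
      by (simp add: B_def dE cong: restrict_cong)
    also have "\<dots> = x"
    proof (rule PiE_restrict)
      show "x \<in> (\<Pi>\<^sub>E I\<in>D. topspace (X I))"
        using x unfolding space_proj_lim proj_lim_set_def by simp
    qed
    finally show "B (E x) = x" .
  qed
qed

section \<open>Regular conditional distributions\<close>

text \<open>The regularization that turns a monotone function on the rationals into a right continuous function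
  on the reals.\<close>

lemma INF_rats_above:
  fixes h :: "rat \<Rightarrow> real"
  assumes mono: "\<And>r s. r \<le> s \<Longrightarrow> h r \<le> h s" and bounds: "\<And>r. 0 \<le> h r" "\<And>r. h r \<le> 1"
  defines "G \<equiv> \<lambda>x::real. INF r\<in>{r. x < of_rat r}. h r"
  shows "x \<le> y \<Longrightarrow> G x \<le> G y"
    and "continuous (at_right x) G"
    and "x < of_rat r \<Longrightarrow> G x \<le> h r"
    and "(\<And>r. x < of_rat r \<Longrightarrow> c \<le> h r) \<Longrightarrow> c \<le> G x"
proof -
  have bdd: "bdd_below (h ` A)" for A using bounds(1) by (rule bdd_belowI2)
  have ne: "{r. x < (of_rat r :: real)} \<noteq> {}" for x
    using of_rat_dense[of x "x + 1"] by auto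
  have lower: "G x \<le> h r" if "x < of_rat r" for x r
    unfolding G_def by (rule cINF_lower[OF bdd]) (use that in simp)
  have greatest: "c \<le> G x" if "\<And>r. x < of_rat r \<Longrightarrow> c \<le> h r" for x c
    unfolding G_def by (rule cINF_greatest[OF ne]) (use that in simp)
  show "x < of_rat r \<Longrightarrow> G x \<le> h r" "(\<And>r. x < of_rat r \<Longrightarrow> c \<le> h r) \<Longrightarrow> c \<le> G x"
    using lower greatest by blast+
  have G_mono: "G x \<le> G y" if "x \<le> y" for x y
    by (rule greatest) (use that in \<open>auto intro: lower\<close>)
  then show "x \<le> y \<Longrightarrow> G x \<le> G y" .
  show "continuous (at_right x) G"
    unfolding continuous_within
  proof (rule order_tendstoI)
    fix a assume "a < G x"
    then show "eventually (\<lambda>y. a < G y) (at_right x)"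
      using G_mono by (intro eventually_at_rightI[of x "x + 1"]) (auto intro: less_le_trans)
  next
    fix a assume "G x < a"
    then obtain r where r: "x < of_rat r" "h r < a"
      using greatest[of x a] by (meson not_le)
    have "G y < a" if "y \<in> {x<..<of_rat r}" for y
      using lower[of y r] r that by auto
    then show "eventually (\<lambda>y. G y < a) (at_right x)"
      using r by (intro eventually_at_rightI[of x "of_rat r"]) auto
  qed
qed

lemma sets_borel_atMost: "sets (borel :: real measure) = sigma_sets UNIV (range (\<lambda>a. {..a}))"
  unfolding borel_eq_atMost by (rule sets_measure_of) simp

text \<open>The conditional law is given by its distribution function, which is built from versions of
  \<open>P[Z \<le> r | S]\<close> for rational \<open>r\<close>. The versions are clamped, made monotone by suprema and made right continuous
  by infima, so that a distribution function is obtained at every point of \<open>\<Omega>\<close> and no exceptional null set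
  has to be removed in an \<open>S\<close>-measurable way. Almost surely, these operations change nothing.
  Conditioning on the events of \<open>S\<close> is expressed by restricting \<open>M\<close> to \<open>E\<close>: the mixture of the conditional
  laws over \<open>E\<close> is the law of \<open>Z\<close> on \<open>E\<close>.\<close>

lemma (in prob_space) real_regular_conditional_distribution:
  assumes sub: "subalgebra M S" and Z [measurable]: "Z \<in> borel_measurable M"
    and Z01: "\<And>\<omega>. \<omega> \<in> space M \<Longrightarrow> Z \<omega> \<in> {0..1::real}"
  obtains \<nu> where "\<nu> \<in> S \<rightarrow>\<^sub>M prob_algebra borel"
    "\<And>E. E \<in> sets S \<Longrightarrow> density M (indicator E) \<bind> \<nu> = distr (density M (indicator E)) borel Z"
proof -
  interpret finite_measure_subalgebra M S by unfold_locales (rule sub)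
  have spS: "space S = space M" using sub by (simp add: subalgebra_def)
  define A where "A r = Z -` {..r} \<inter> space M" for r
  have A [measurable]: "A r \<in> sets M" for r unfolding A_def by measurable
  have A_int: "integrable M (indicat_real (A r))" for r
    by (intro integrable_real_indicator A) (simp add: less_top[symmetric])
  define F where "F r = cond_prob_on M S (A r)" for r
  have F_meas [measurable]: "F r \<in> borel_measurable S" for r
    unfolding F_def cond_prob_on_def by simp
  \<comment> \<open>The values outside the unit interval are prescribed, since \<open>Z\<close> has values in it.\<close>
  define F' where "F' r \<omega> = (if r < 0 then 0 else if 1 \<le> r then 1 else max 0 (min 1 (F (of_rat r) \<omega>)))"
    for r :: rat and \<omega>
  have F'_meas [measurable]: "F' r \<in> borel_measurable S" for r unfolding F'_def by measurable
  have F'_bounds: "0 \<le> F' r \<omega>" "F' r \<omega> \<le> 1" for r \<omega> by (auto simp: F'_def)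
  define H where "H r \<omega> = (SUP s\<in>{..r}. F' s \<omega>)" for r \<omega>
  define G where "G \<omega> x = (INF r\<in>{r. x < of_rat r}. H r \<omega>)" for \<omega> and x :: real
  have bdd: "bdd_above ((\<lambda>s. F' s \<omega>) ` R)" for \<omega> R using F'_bounds(2) by (rule bdd_aboveI2)
  have H_mono: "H r \<omega> \<le> H s \<omega>" if "r \<le> s" for r s \<omega>
    unfolding H_def by (rule cSUP_subset_mono) (use that bdd in auto)
  have H_ge: "F' s \<omega> \<le> H r \<omega>" if "s \<le> r" for s r \<omega>
    unfolding H_def by (rule cSUP_upper[OF _ bdd]) (use that in simp)
  have H_le: "H r \<omega> \<le> c" if "\<And>s. s \<le> r \<Longrightarrow> F' s \<omega> \<le> c" for r \<omega> c
    unfolding H_def by (rule cSUP_least) (use that in auto)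
  have H_bounds: "0 \<le> H r \<omega>" "H r \<omega> \<le> 1" for r \<omega>
    using order_trans[OF F'_bounds(1) H_ge[of r r \<omega>]] H_le[OF F'_bounds(2)] by auto
  have H_meas [measurable]: "H r \<in> borel_measurable S" for r
    unfolding H_def by (rule borel_measurable_cSUP) (auto intro: bdd)
  have G_mono: "G \<omega> x \<le> G \<omega> y" if "x \<le> y" for \<omega> x y
    unfolding G_def using INF_rats_above(1)[OF H_mono H_bounds that] .
  have G_cont: "continuous (at_right x) (G \<omega>)" for \<omega> x
    unfolding G_def using INF_rats_above(2)[OF H_mono H_bounds] .
  have G_le: "G \<omega> x \<le> H r \<omega>" if "x < of_rat r" for \<omega> x r
    unfolding G_def using INF_rats_above(3)[OF H_mono H_bounds that] .
  have G_ge: "c \<le> G \<omega> x" if "\<And>r. x < of_rat r \<Longrightarrow> c \<le> H r \<omega>" for c \<omega> x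
    unfolding G_def using INF_rats_above(4)[OF H_mono H_bounds that] .
  have G_meas [measurable]: "(\<lambda>\<omega>. G \<omega> x) \<in> borel_measurable S" for x
    unfolding G_def by (rule borel_measurable_cINF) (use H_bounds in \<open>auto intro!: bdd_belowI2\<close>)
  have G0: "G \<omega> x = 0" if "x < 0" for \<omega> x
  proof (rule antisym)
    obtain r where r: "x < of_rat r" "of_rat r < (0::real)" using of_rat_dense[OF \<open>x < 0\<close>] by auto
    have "G \<omega> x \<le> H r \<omega>" by (rule G_le[OF r(1)])
    also have "\<dots> \<le> 0" by (rule H_le) (use r in \<open>auto simp: F'_def\<close>)
    finally show "G \<omega> x \<le> 0" .
  qed (intro G_ge H_bounds)
  have G1: "G \<omega> x = 1" if "1 \<le> x" for \<omega> x
  proof (rule antisym)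
    obtain r where r: "x < of_rat r" using of_rat_dense[of x "x + 1"] by auto
    show "G \<omega> x \<le> 1" using G_le[OF r] H_bounds(2) by (rule order_trans)
    show "1 \<le> G \<omega> x"
    proof (rule G_ge)
      fix r assume "x < of_rat r"
      then have "1 < (of_rat r :: real)" using that by linarith
      then have "1 \<le> r" by simp
      then have "F' r \<omega> = 1" by (auto simp: F'_def)
      then show "1 \<le> H r \<omega>" using H_ge[of r r \<omega>] by simp
    qed
  qed
  have G_bot: "(G \<omega> \<longlongrightarrow> 0) at_bot" for \<omega>
    by (rule tendsto_eventually) (auto simp: eventually_at_bot_dense intro!: exI[of _ 0] G0)
  have G_top: "(G \<omega> \<longlongrightarrow> 1) at_top" for \<omega>
    by (rule tendsto_eventually) (auto simp: eventually_at_top_linorder intro!: exI[of _ 1] G1)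
  define \<nu> where "\<nu> \<omega> = interval_measure (G \<omega>)" for \<omega>
  have \<nu>_dist: "real_distribution (\<nu> \<omega>)" for \<omega>
    unfolding \<nu>_def by (rule real_distribution_interval_measure[OF G_mono G_cont G_bot G_top])
  have \<nu>_Iic: "emeasure (\<nu> \<omega>) {..x} = ennreal (G \<omega> x)" for \<omega> x
    unfolding \<nu>_def by (rule emeasure_interval_measure_Iic[OF G_mono G_cont G_bot])
  have \<nu>: "\<nu> \<in> S \<rightarrow>\<^sub>M prob_algebra borel"
  proof (rule measurable_prob_algebra_generated[OF sets_borel_atMost])
    show "Int_stable (range (\<lambda>a::real. {..a}))" by (auto simp: Int_stable_def)
    show "prob_space (\<nu> \<omega>)" "sets (\<nu> \<omega>) = sets borel" for \<omega>
      using \<nu>_dist[of \<omega>] by (auto simp: real_distribution_def real_distribution_axioms_def)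
    show "(\<lambda>\<omega>. emeasure (\<nu> \<omega>) C) \<in> borel_measurable S" if "C \<in> range (\<lambda>a. {..a})" for C
      using that by (auto simp: \<nu>_Iic)
  qed auto

  have F_mono: "AE \<omega> in M. F x \<omega> \<le> F y \<omega>" if "x \<le> y" for x y
    unfolding F_def cond_prob_on_def
    by (rule real_cond_exp_mono) (use that A_int in \<open>auto simp: A_def indicator_def\<close>)
  have F_neg: "AE \<omega> in M. F x \<omega> = 0" if "x < 0" for x
  proof -
    have "A x = {}" using Z01 that by (force simp: A_def)
    then show ?thesis unfolding F_def cond_prob_on_def
      using real_cond_exp_F_meas[of "indicat_real (A x)"] A_int by simp
  qed
  have F_one: "AE \<omega> in M. F x \<omega> = 1" if "1 \<le> x" for x
  proof -
    have "A x = space S" using Z01 that by (force simp: A_def spS)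
    then have "indicat_real (A x) \<in> borel_measurable S" by simp
    from real_cond_exp_F_meas[OF A_int this] show ?thesis
      unfolding F_def cond_prob_on_def using AE_space by eventually_elim (use \<open>A x = space S\<close> spS in simp)
  qed
  have H_F: "AE \<omega> in M. \<forall>r. H r \<omega> = F (of_rat r) \<omega>"
  proof -
    have 1: "AE \<omega> in M. \<forall>r s. r \<le> s \<longrightarrow> F (of_rat r) \<omega> \<le> F (of_rat s) \<omega>"
      by (simp add: AE_all_countable) (auto intro!: F_mono simp: of_rat_less_eq)
    have 2: "AE \<omega> in M. \<forall>r::rat. r < 0 \<longrightarrow> F (of_rat r) \<omega> = 0"
      by (simp add: AE_all_countable) (auto intro!: F_neg)
    have 3: "AE \<omega> in M. \<forall>r::rat. 1 \<le> r \<longrightarrow> F (of_rat r) \<omega> = 1"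
      by (simp add: AE_all_countable) (auto intro!: F_one)
    from 1 2 3 show ?thesis
    proof eventually_elim
      case (elim \<omega>)
      have "0 \<le> F (of_rat r) \<omega>" "F (of_rat r) \<omega> \<le> 1" for r
      proof -
        have "F (of_rat (min r (-1))) \<omega> \<le> F (of_rat r) \<omega>" "F (of_rat r) \<omega> \<le> F (of_rat (max r 1)) \<omega>"
          using elim(1) by auto
        moreover have "F (of_rat (min r (-1))) \<omega> = 0" "F (of_rat (max r 1)) \<omega> = 1"
          using elim(2,3) by auto
        ultimately show "0 \<le> F (of_rat r) \<omega>" "F (of_rat r) \<omega> \<le> 1" by auto
      qed
      then have F': "F' r \<omega> = F (of_rat r) \<omega>" for r
        using elim(2,3) by (auto simp: F'_def)
      show ?case
      proof
        fix r
        show "H r \<omega> = F (of_rat r) \<omega>"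
          using H_ge[of r r \<omega>] H_le[of r \<omega> "F (of_rat r) \<omega>"] elim(1) by (auto simp: F')
      qed
    qed
  qed
  have F_int: "(\<integral>\<^sup>+\<omega>\<in>E. ennreal (F x \<omega>) \<partial>M) = emeasure M (A x \<inter> E)" if "E \<in> sets S" for x E
    using cond_prob_on_disintegrates[OF sub A] that by (simp add: F_def disintegrates_def)
  show thesis
  proof (rule that[OF \<nu>])
    fix E assume E: "E \<in> sets S"
    then have EM [measurable]: "E \<in> sets M" using sub by (auto simp: subalgebra_def)
    let ?\<mu> = "density M (indicator E)"
    have \<nu>M: "\<nu> \<in> ?\<mu> \<rightarrow>\<^sub>M subprob_algebra borel"
      using measurable_prob_algebraD[OF measurable_from_subalg[OF sub \<nu>]] by simp
    have sp: "space ?\<mu> \<noteq> {}" using not_empty by simp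
    have dist: "emeasure (distr ?\<mu> borel Z) {..x} = emeasure M (A x \<inter> E)" for x
    proof -
      have "emeasure (distr ?\<mu> borel Z) {..x} = emeasure ?\<mu> (A x)"
        by (simp add: emeasure_distr A_def)
      also have "\<dots> = (\<integral>\<^sup>+\<omega>. indicator E \<omega> * indicator (A x) \<omega> \<partial>M)"
        by (rule emeasure_density) auto
      also have "\<dots> = (\<integral>\<^sup>+\<omega>. indicator (A x \<inter> E) \<omega> \<partial>M)"
        by (rule nn_integral_cong) (simp split: split_indicator)
      finally show ?thesis by simp
    qed
    have bind: "emeasure (?\<mu> \<bind> \<nu>) {..x} = (\<integral>\<^sup>+\<omega>\<in>E. ennreal (G \<omega> x) \<partial>M)" for x
    proof -
      have [measurable]: "(\<lambda>\<omega>. G \<omega> x) \<in> borel_measurable M" by (rule measurable_from_subalg[OF sub G_meas])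
      have "emeasure (?\<mu> \<bind> \<nu>) {..x} = (\<integral>\<^sup>+\<omega>. ennreal (G \<omega> x) \<partial>?\<mu>)"
        by (subst emeasure_bind[OF sp \<nu>M]) (auto simp: \<nu>_Iic)
      also have "\<dots> = (\<integral>\<^sup>+\<omega>. indicator E \<omega> * ennreal (G \<omega> x) \<partial>M)"
        by (rule nn_integral_density) auto
      finally show ?thesis by (simp add: mult.commute)
    qed
    have fin: "finite_measure (distr ?\<mu> borel Z)"
    proof (rule finite_measureI)
      have "emeasure (distr ?\<mu> borel Z) (space (distr ?\<mu> borel Z)) = emeasure M E"
        by (simp add: emeasure_distr emeasure_density cong: nn_integral_cong)
      then show "emeasure (distr ?\<mu> borel Z) (space (distr ?\<mu> borel Z)) \<noteq> \<infinity>" by simp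
    qed
    \<comment> \<open>Almost surely \<open>F x \<le> G x \<le> F r\<close> for rational \<open>r > x\<close>; the gap closes as \<open>r\<close> tends to \<open>x\<close>.\<close>
    have eq: "emeasure (?\<mu> \<bind> \<nu>) {..x} = emeasure (distr ?\<mu> borel Z) {..x}" for x
    proof (rule antisym)
      have up: "(\<integral>\<^sup>+\<omega>\<in>E. ennreal (G \<omega> x) \<partial>M) \<le> emeasure (distr ?\<mu> borel Z) {..of_rat r}"
        if "x < of_rat r" for r
        unfolding dist F_int[OF E, symmetric]
      proof (rule nn_integral_mono_AE)
        show "AE \<omega> in M. ennreal (G \<omega> x) * indicator E \<omega> \<le> ennreal (F (of_rat r) \<omega>) * indicator E \<omega>"
          using H_F
        proof eventually_elim
          case (elim \<omega>)
          then have "G \<omega> x \<le> F (of_rat r) \<omega>" using G_le[OF that, of \<omega>] by simp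
          then show ?case by (auto intro!: mult_right_mono ennreal_leI)
        qed
      qed
      have "((\<lambda>y. emeasure (distr ?\<mu> borel Z) {..y}) \<longlongrightarrow> emeasure (distr ?\<mu> borel Z) {..x}) (at_right x)"
      proof -
        interpret D: finite_borel_measure "distr ?\<mu> borel Z"
          by (intro finite_borel_measure.intro fin finite_borel_measure_axioms.intro) simp
        have "(cdf (distr ?\<mu> borel Z) \<longlongrightarrow> cdf (distr ?\<mu> borel Z) x) (at_right x)"
          using D.cdf_is_right_cont[of x] by (simp add: continuous_within)
        then show ?thesis by (simp add: D.emeasure_eq_measure cdf_def tendsto_ennrealI)
      qed
      moreover have "eventually (\<lambda>y. (\<integral>\<^sup>+\<omega>\<in>E. ennreal (G \<omega> x) \<partial>M)
          \<le> emeasure (distr ?\<mu> borel Z) {..y}) (at_right x)"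
      proof (rule eventually_at_rightI[of x "x + 1"])
        fix y assume "y \<in> {x<..<x + 1}"
        then obtain r where r: "x < of_rat r" "of_rat r < y" using of_rat_dense[of x y] by auto
        note up[OF r(1)]
        also have "emeasure (distr ?\<mu> borel Z) {..of_rat r} \<le> emeasure (distr ?\<mu> borel Z) {..y}"
          by (rule emeasure_mono) (use r in auto)
        finally show "(\<integral>\<^sup>+\<omega>\<in>E. ennreal (G \<omega> x) \<partial>M) \<le> emeasure (distr ?\<mu> borel Z) {..y}" .
      qed simp
      ultimately show "emeasure (?\<mu> \<bind> \<nu>) {..x} \<le> emeasure (distr ?\<mu> borel Z) {..x}"
        unfolding bind by (rule tendsto_lowerbound) simp
      show "emeasure (distr ?\<mu> borel Z) {..x} \<le> emeasure (?\<mu> \<bind> \<nu>) {..x}"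
        unfolding bind dist F_int[OF E, symmetric]
      proof (rule nn_integral_mono_AE)
        have "AE \<omega> in M. \<forall>r. x < of_rat r \<longrightarrow> F x \<omega> \<le> F (of_rat r) \<omega>"
          by (simp add: AE_all_countable) (auto intro!: F_mono)
        then show "AE \<omega> in M. ennreal (F x \<omega>) * indicator E \<omega> \<le> ennreal (G \<omega> x) * indicator E \<omega>"
          using H_F
        proof eventually_elim
          case (elim \<omega>)
          then have "F x \<omega> \<le> G \<omega> x" by (intro G_ge) simp
          then show ?case by (auto intro!: mult_right_mono ennreal_leI)
        qed
      qed
    qed
    show "?\<mu> \<bind> \<nu> = distr ?\<mu> borel Z"
    proof (rule measure_eqI_generator_eq[where E = "range (\<lambda>a::real. {..a})" and \<Omega> = UNIV
          and A = "\<lambda>i. {..real i}"])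
      show "Int_stable (range (\<lambda>a::real. {..a}))" by (auto simp: Int_stable_def)
      show "emeasure (?\<mu> \<bind> \<nu>) C = emeasure (distr ?\<mu> borel Z) C" if "C \<in> range (\<lambda>a. {..a})" for C
        using that eq by auto
      show "sets (?\<mu> \<bind> \<nu>) = sigma_sets UNIV (range (\<lambda>a::real. {..a}))"
        by (subst sets_bind[OF sets_kernel[OF \<nu>M] sp]) (simp_all add: sets_borel_atMost)
      show "(\<Union>i. {..real i}) = UNIV" using real_arch_simple by auto
      show "emeasure (?\<mu> \<bind> \<nu>) {..real i} \<noteq> \<infinity>" for i
        unfolding eq using finite_measure.emeasure_finite[OF fin] by simp
    qed (auto simp: sets_borel_atMost)
  qed
qed

text \<open>The conditional law of the code of \<open>\<Theta>\<close> is decoded.\<close>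

lemma (in prob_space) regular_conditional_distribution:
  assumes sub: "subalgebra M S" and \<Theta>: "\<Theta> \<in> M \<rightarrow>\<^sub>M N" and retract: "measurable_retract N baire_space"
  obtains \<nu> where "\<nu> \<in> S \<rightarrow>\<^sub>M prob_algebra N"
    "\<And>E. E \<in> sets S \<Longrightarrow> density M (indicator E) \<bind> \<nu> = distr (density M (indicator E)) N \<Theta>"
proof -
  obtain e b where e: "e \<in> N \<rightarrow>\<^sub>M restrict_space borel {0..1::real}"
    and b: "b \<in> restrict_space borel {0..1::real} \<rightarrow>\<^sub>M N" and be: "\<forall>x\<in>space N. b (e x) = x"
    by (rule measurable_retractE[OF measurable_retract_trans[OF retract baire_space_measurable_retract]])
  define Z where "Z \<omega> = e (\<Theta> \<omega>)" for \<omega>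
  have "Z \<in> M \<rightarrow>\<^sub>M restrict_space borel {0..1}"
    unfolding Z_def by (rule measurable_compose[OF \<Theta> e])
  then have Z: "Z \<in> borel_measurable M" and Z01: "\<And>\<omega>. \<omega> \<in> space M \<Longrightarrow> Z \<omega> \<in> {0..1}"
    unfolding measurable_restrict_space2_iff by (blast, blast)
  \<comment> \<open>The decoding map is extended from the unit interval to the whole line.\<close>
  define c where "c z = b (max 0 (min 1 z))" for z :: real
  have c: "c \<in> borel \<rightarrow>\<^sub>M N"
    unfolding c_def by (rule measurable_compose[OF measurable_restrict_space2 b]) auto
  have cZ: "c (Z \<omega>) = \<Theta> \<omega>" if "\<omega> \<in> space M" for \<omega>
    using Z01[OF that] be measurable_space[OF \<Theta> that] by (simp add: c_def Z_def)
  obtain \<nu> where \<nu>: "\<nu> \<in> S \<rightarrow>\<^sub>M prob_algebra borel"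
    and \<nu>_eq: "\<And>E. E \<in> sets S \<Longrightarrow> density M (indicator E) \<bind> \<nu> = distr (density M (indicator E)) borel Z"
    using real_regular_conditional_distribution[OF sub Z Z01] by blast
  show thesis
  proof (rule that)
    show "(\<lambda>\<omega>. distr (\<nu> \<omega>) N c) \<in> S \<rightarrow>\<^sub>M prob_algebra N"
      by (rule measurable_compose[OF \<nu> measurable_distr_prob_space[OF c]])
    fix E assume E: "E \<in> sets S"
    let ?\<mu> = "density M (indicator E)"
    have "\<nu> \<in> ?\<mu> \<rightarrow>\<^sub>M subprob_algebra borel"
      using measurable_prob_algebraD[OF measurable_from_subalg[OF sub \<nu>]] by simp
    then have "?\<mu> \<bind> (\<lambda>\<omega>. distr (\<nu> \<omega>) N c) = distr (?\<mu> \<bind> \<nu>) N c"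
      by (rule distr_bind[symmetric]) (simp_all add: not_empty c)
    also have "\<dots> = distr ?\<mu> N (c \<circ> Z)"
      unfolding \<nu>_eq[OF E] by (rule distr_distr) (use c Z in auto)
    also have "\<dots> = distr ?\<mu> N \<Theta>"
      by (rule distr_cong) (auto simp: cZ)
    finally show "?\<mu> \<bind> (\<lambda>\<omega>. distr (\<nu> \<omega>) N c) = distr ?\<mu> N \<Theta>" .
  qed
qed

text \<open>Averaging over the conditional law of \<open>\<Theta>\<close> makes a kernel exactly \<open>S\<close>-measurable, and not only up
  to null sets, and its values remain measures on \<open>R\<close>. For arbitrary \<open>R\<close> neither follows from
  the existence of conditional expectations.\<close>

lemma (in prob_space) averaged_kernel:
  assumes sub: "subalgebra M S" and \<Theta>: "\<Theta> \<in> M \<rightarrow>\<^sub>M N" and retract: "measurable_retract N baire_space"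
    and Q: "Q \<in> N \<rightarrow>\<^sub>M prob_algebra R"
  obtains k where "k \<in> S \<rightarrow>\<^sub>M prob_algebra R"
    "\<And>E A. E \<in> sets S \<Longrightarrow> A \<in> sets R \<Longrightarrow>
      (\<integral>\<^sup>+\<omega>\<in>E. emeasure (k \<omega>) A \<partial>M) = (\<integral>\<^sup>+\<omega>\<in>E. emeasure (Q (\<Theta> \<omega>)) A \<partial>M)"
proof -
  obtain \<nu> where \<nu>: "\<nu> \<in> S \<rightarrow>\<^sub>M prob_algebra N"
    and \<nu>_eq: "\<And>E. E \<in> sets S \<Longrightarrow> density M (indicator E) \<bind> \<nu> = distr (density M (indicator E)) N \<Theta>"
    using regular_conditional_distribution[OF sub \<Theta> retract] by blast
  show thesis
  proof (rule that)
    show k: "(\<lambda>\<omega>. \<nu> \<omega> \<bind> Q) \<in> S \<rightarrow>\<^sub>M prob_algebra R"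
      by (rule measurable_bind_prob_space[OF \<nu> Q])
    fix E A assume E: "E \<in> sets S" and A: "A \<in> sets R"
    have [measurable]: "E \<in> sets M" using sub E by (auto simp: subalgebra_def)
    let ?\<mu> = "density M (indicator E)"
    have Q_meas: "(\<lambda>z. emeasure (Q z) A) \<in> borel_measurable N"
      by (rule measurable_compose[OF measurable_prob_algebraD[OF Q] measurable_emeasure_subprob_algebra[OF A]])
    have k_meas: "(\<lambda>\<omega>. emeasure (\<nu> \<omega> \<bind> Q) A) \<in> borel_measurable M"
      by (rule measurable_compose[OF measurable_prob_algebraD[OF measurable_from_subalg[OF sub k]]
            measurable_emeasure_subprob_algebra[OF A]])
    have \<nu>M: "\<nu> \<in> ?\<mu> \<rightarrow>\<^sub>M subprob_algebra N"
      using measurable_prob_algebraD[OF measurable_from_subalg[OF sub \<nu>]] by simp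
    have "(\<integral>\<^sup>+\<omega>\<in>E. emeasure (\<nu> \<omega> \<bind> Q) A \<partial>M) = (\<integral>\<^sup>+\<omega>. emeasure (\<nu> \<omega> \<bind> Q) A \<partial>?\<mu>)"
      by (subst nn_integral_density) (auto simp: k_meas mult.commute)
    also have "\<dots> = (\<integral>\<^sup>+\<omega>. \<integral>\<^sup>+z. emeasure (Q z) A \<partial>\<nu> \<omega> \<partial>?\<mu>)"
    proof (rule nn_integral_cong)
      fix \<omega> assume "\<omega> \<in> space ?\<mu>"
      then have "\<nu> \<omega> \<in> space (prob_algebra N)"
        using measurable_space[OF \<nu>] sub by (simp add: subalgebra_def)
      then show "emeasure (\<nu> \<omega> \<bind> Q) A = (\<integral>\<^sup>+z. emeasure (Q z) A \<partial>\<nu> \<omega>)"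
        by (rule emeasure_bind_prob_algebra[OF _ Q A])
    qed
    also have "\<dots> = (\<integral>\<^sup>+z. emeasure (Q z) A \<partial>(?\<mu> \<bind> \<nu>))"
      by (rule nn_integral_bind[OF Q_meas \<nu>M, symmetric])
    also have "\<dots> = (\<integral>\<^sup>+\<omega>. emeasure (Q (\<Theta> \<omega>)) A \<partial>?\<mu>)"
      unfolding \<nu>_eq[OF E] by (rule nn_integral_distr) (use \<Theta> Q_meas in auto)
    also have "\<dots> = (\<integral>\<^sup>+\<omega>\<in>E. emeasure (Q (\<Theta> \<omega>)) A \<partial>M)"
      by (subst nn_integral_density) (auto simp: measurable_compose[OF \<Theta> Q_meas] mult.commute)
    finally show "(\<integral>\<^sup>+\<omega>\<in>E. emeasure (\<nu> \<omega> \<bind> Q) A \<partial>M) = (\<integral>\<^sup>+\<omega>\<in>E. emeasure (Q (\<Theta> \<omega>)) A \<partial>M)" .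
  qed
qed

section \<open>Sufficiency\<close>

lemma emeasure_kernel_eq_measure:
  assumes "k \<in> M \<rightarrow>\<^sub>M prob_algebra R" "\<omega> \<in> space M"
  shows "emeasure (k \<omega>) A = ennreal (measure (k \<omega>) A)"
proof -
  have "prob_space (k \<omega>)" using measurable_space[OF assms] by (simp add: space_prob_algebra)
  then interpret prob_space "k \<omega>" .
  show ?thesis by (rule emeasure_eq_measure)
qed

lemma subalgebra_gen_by: "\<Theta> \<in> M \<rightarrow>\<^sub>M T \<Longrightarrow> subalgebra M (gen_by M \<Theta> T)"
  by (simp add: subalgebra_def sets_image_in_sets)

lemma subalgebra_sigma:
  assumes "\<E> \<subseteq> sets M"
  shows "subalgebra M (sigma (space M) \<E>)" "sets (sigma (space M) \<E>) = sigma_sets (space M) \<E>"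
proof -
  have "\<E> \<subseteq> Pow (space M)" using assms sets.sets_into_space by blast
  then show "sets (sigma (space M) \<E>) = sigma_sets (space M) \<E>" by (rule sets_measure_of)
  then show "subalgebra M (sigma (space M) \<E>)"
    using sets.sigma_sets_subset[OF assms] \<open>\<E> \<subseteq> Pow (space M)\<close> by (simp add: subalgebra_def)
qed

lemma gen_by_subset:
  assumes "\<gamma> \<in> T' \<rightarrow>\<^sub>M T" "\<Theta>' \<in> M \<rightarrow>\<^sub>M T'" "\<And>\<omega>. \<omega> \<in> space M \<Longrightarrow> \<Theta> \<omega> = \<gamma> (\<Theta>' \<omega>)"
  shows "sets (gen_by M \<Theta> T) \<subseteq> sets (gen_by M \<Theta>' T')"
proof (rule sets_image_in_sets)
  have "\<Theta>' \<in> gen_by M \<Theta>' T' \<rightarrow>\<^sub>M T'"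
    by (rule measurable_vimage_algebra1) (use measurable_space[OF assms(2)] in blast)
  then have "(\<lambda>\<omega>. \<gamma> (\<Theta>' \<omega>)) \<in> gen_by M \<Theta>' T' \<rightarrow>\<^sub>M T"
    using assms(1) by (rule measurable_compose)
  then show "\<Theta> \<in> gen_by M \<Theta>' T' \<rightarrow>\<^sub>M T"
    by (subst measurable_cong[where g = "\<lambda>\<omega>. \<gamma> (\<Theta>' \<omega>)"]) (simp_all add: assms(3))
qed simp

lemma (in prob_space) sufficient_iff_disintegrates:
  assumes \<Theta>: "\<Theta> \<in> M \<rightarrow>\<^sub>M T" and X: "X \<in> M \<rightarrow>\<^sub>M N"
  shows "sufficient M N X T \<Theta> S \<longleftrightarrow> subalgebra M S \<and>
    (\<exists>k \<in> M \<rightarrow>\<^sub>M prob_algebra M. \<forall>B\<in>sets N.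
      (\<lambda>\<omega>. measure (k \<omega>) (X -` B \<inter> space M)) \<in> borel_measurable S \<and>
      disintegrates M (sigma_sets (space M) (sets (gen_by M \<Theta> T) \<union> sets S)) (X -` B \<inter> space M)
        (\<lambda>\<omega>. measure (k \<omega>) (X -` B \<inter> space M)))"
proof (cases "subalgebra M S")
  case S: True
  let ?J = "sigma (space M) (sets (gen_by M \<Theta> T) \<union> sets S)"
  have un: "sets (gen_by M \<Theta> T) \<union> sets S \<subseteq> sets M"
    using subalgebra_gen_by[OF \<Theta>] S by (simp add: subalgebra_def)
  note J = subalgebra_sigma[OF un]
  have SJ: "subalgebra ?J S"
  proof -
    have "space ?J = space S" using J(1) S by (simp add: subalgebra_def)
    moreover have "sets S \<subseteq> sets ?J" unfolding J(2) by (auto intro: sigma_sets.Basic)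
    ultimately show ?thesis by (simp add: subalgebra_def)
  qed
  have "(AE \<omega> in M. cond_prob_on M ?J A \<omega> = h \<omega>) \<longleftrightarrow> disintegrates M (sets ?J) A h"
    if A: "A \<in> sets M" and h: "h \<in> borel_measurable S" "\<And>\<omega>. 0 \<le> h \<omega>" for A h
  proof
    assume "AE \<omega> in M. cond_prob_on M ?J A \<omega> = h \<omega>"
    then show "disintegrates M (sets ?J) A h"
      using cond_prob_on_disintegrates[OF J(1) A] by (subst (asm) disintegrates_cong_AE)
  next
    assume "disintegrates M (sets ?J) A h"
    then show "AE \<omega> in M. cond_prob_on M ?J A \<omega> = h \<omega>"
      by (intro AE_cond_prob_on_eqI J(1) A measurable_from_subalg[OF SJ] h AE_I2)
  qed
  then show ?thesis
    using measurable_sets[OF X] S by (simp add: sufficient_def J(2) cong: conj_cong)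
qed (simp add: sufficient_def)

text \<open>The kernel of \<open>S\<close> for \<open>X'\<close> and \<open>\<Theta>'\<close> also works for \<open>X\<close> and \<open>\<Theta>\<close>: its values are \<open>S\<close>-measurable as
  they stand, and they only have to pass fewer tests.\<close>

lemma (in prob_space) sufficient_coarser:
  assumes suff: "sufficient M N' X' T' \<Theta>' S"
    and \<Theta>': "\<Theta>' \<in> M \<rightarrow>\<^sub>M T'" and X': "X' \<in> M \<rightarrow>\<^sub>M N'"
    and \<gamma>: "\<gamma> \<in> T' \<rightarrow>\<^sub>M T" and \<Theta>: "\<And>\<omega>. \<omega> \<in> space M \<Longrightarrow> \<Theta> \<omega> = \<gamma> (\<Theta>' \<omega>)"
    and \<phi>: "\<phi> \<in> N' \<rightarrow>\<^sub>M N" and X: "\<And>\<omega>. \<omega> \<in> space M \<Longrightarrow> X \<omega> = \<phi> (X' \<omega>)"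
  shows "sufficient M N X T \<Theta> S"
proof -
  have \<Theta>_meas: "\<Theta> \<in> M \<rightarrow>\<^sub>M T"
    using measurable_compose[OF \<Theta>' \<gamma>] by (subst measurable_cong[OF \<Theta>])
  have X_meas: "X \<in> M \<rightarrow>\<^sub>M N"
    using measurable_compose[OF X' \<phi>] by (subst measurable_cong[OF X])
  obtain k where S: "subalgebra M S" and k: "k \<in> M \<rightarrow>\<^sub>M prob_algebra M"
    and k_suff: "\<And>B. B \<in> sets N' \<Longrightarrow>
      (\<lambda>\<omega>. measure (k \<omega>) (X' -` B \<inter> space M)) \<in> borel_measurable S \<and>
      disintegrates M (sigma_sets (space M) (sets (gen_by M \<Theta>' T') \<union> sets S)) (X' -` B \<inter> space M)
        (\<lambda>\<omega>. measure (k \<omega>) (X' -` B \<inter> space M))"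
    using suff unfolding sufficient_iff_disintegrates[OF \<Theta>' X'] by blast
  have sub: "sigma_sets (space M) (sets (gen_by M \<Theta> T) \<union> sets S)
      \<subseteq> sigma_sets (space M) (sets (gen_by M \<Theta>' T') \<union> sets S)"
    by (rule sigma_sets_subseteq) (use gen_by_subset[OF \<gamma> \<Theta>' \<Theta>] in blast)
  show ?thesis
    unfolding sufficient_iff_disintegrates[OF \<Theta>_meas X_meas]
  proof (intro conjI S bexI[OF _ k] ballI)
    fix B assume B: "B \<in> sets N"
    have eq: "X -` B \<inter> space M = X' -` (\<phi> -` B \<inter> space N') \<inter> space M"
      using X measurable_space[OF X'] by auto
    note k_suff = k_suff[OF measurable_sets[OF \<phi> B], folded eq]
    show "(\<lambda>\<omega>. measure (k \<omega>) (X -` B \<inter> space M)) \<in> borel_measurable S"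
      using k_suff by blast
    show "disintegrates M (sigma_sets (space M) (sets (gen_by M \<Theta> T) \<union> sets S)) (X -` B \<inter> space M)
        (\<lambda>\<omega>. measure (k \<omega>) (X -` B \<inter> space M))"
      using k_suff sub by (blast intro: disintegrates_subset)
  qed
qed

lemma cond_prob_given_measurable:
  assumes "cond_prob_given M T \<Theta> Q" "A \<in> sets M"
  shows "(\<lambda>\<theta>. measure (Q \<theta>) A) \<in> borel_measurable T"
  using assms unfolding cond_prob_given_def
  by (intro measurable_compose[OF _ measurable_measure_prob_algebra]) auto

lemma (in prob_space) cond_prob_given_disintegrates:
  assumes Q: "cond_prob_given M T \<Theta> Q" and \<Theta>: "\<Theta> \<in> M \<rightarrow>\<^sub>M T" and A: "A \<in> sets M"
  shows "disintegrates M (sets (gen_by M \<Theta> T)) A (\<lambda>\<omega>. measure (Q (\<Theta> \<omega>)) A)"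
proof -
  have "AE \<omega> in M. measure (Q (\<Theta> \<omega>)) A = cond_prob_on M (gen_by M \<Theta> T) A \<omega>"
    using Q A unfolding cond_prob_given_def by blast
  then show ?thesis
    using cond_prob_on_disintegrates[OF subalgebra_gen_by[OF \<Theta>] A] by (subst disintegrates_cong_AE)
qed

lemma (in prob_space) cond_prob_given_total_probability:
  assumes Q: "cond_prob_given M T \<Theta> Q" and \<Theta>: "\<Theta> \<in> M \<rightarrow>\<^sub>M T" and A: "A \<in> sets M"
  shows "(\<integral>\<^sup>+\<omega>. ennreal (measure (Q (\<Theta> \<omega>)) A) \<partial>M) = emeasure M A"
proof -
  have top: "space M \<in> sets (gen_by M \<Theta> T)" using sets.top[of "gen_by M \<Theta> T"] by simp
  have "(\<integral>\<^sup>+\<omega>. ennreal (measure (Q (\<Theta> \<omega>)) A) \<partial>M)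
      = (\<integral>\<^sup>+\<omega>\<in>space M. ennreal (measure (Q (\<Theta> \<omega>)) A) \<partial>M)"
    by (rule nn_integral_cong) simp
  also have "\<dots> = emeasure M (A \<inter> space M)"
    using cond_prob_given_disintegrates[OF Q \<Theta> A] top unfolding disintegrates_def by (rule bspec)
  finally show ?thesis using A by simp
qed

text \<open>The conditional probability given \<open>\<Theta>\<close>, as a kernel on \<open>\<Omega>\<close>, is its own witness, since
  \<open>\<sigma>(\<Theta>) \<or> \<sigma>(\<Theta>)\<close> is \<open>\<sigma>(\<Theta>)\<close>.\<close>

lemma (in prob_space) gen_by_sufficient:
  assumes Q: "cond_prob_given M T \<Theta> Q" and \<Theta>: "\<Theta> \<in> M \<rightarrow>\<^sub>M T" and X: "X \<in> M \<rightarrow>\<^sub>M N"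
  shows "sufficient M N X T \<Theta> (gen_by M \<Theta> T)"
  unfolding sufficient_iff_disintegrates[OF \<Theta> X]
proof (intro conjI subalgebra_gen_by[OF \<Theta>])
  have Q_meas: "Q \<in> T \<rightarrow>\<^sub>M prob_algebra M" using Q unfolding cond_prob_given_def by blast
  have \<Theta>_gen: "\<Theta> \<in> gen_by M \<Theta> T \<rightarrow>\<^sub>M T"
    by (rule measurable_vimage_algebra1) (use measurable_space[OF \<Theta>] in blast)
  have gen: "sigma_sets (space M) (sets (gen_by M \<Theta> T) \<union> sets (gen_by M \<Theta> T)) = sets (gen_by M \<Theta> T)"
    using sets.sigma_sets_eq[of "gen_by M \<Theta> T"] by simp
  show "\<exists>k\<in>M \<rightarrow>\<^sub>M prob_algebra M. \<forall>B\<in>sets N.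
      (\<lambda>\<omega>. measure (k \<omega>) (X -` B \<inter> space M)) \<in> borel_measurable (gen_by M \<Theta> T) \<and>
      disintegrates M (sigma_sets (space M) (sets (gen_by M \<Theta> T) \<union> sets (gen_by M \<Theta> T)))
        (X -` B \<inter> space M) (\<lambda>\<omega>. measure (k \<omega>) (X -` B \<inter> space M))"
    unfolding gen
  proof (intro bexI[of _ "\<lambda>\<omega>. Q (\<Theta> \<omega>)"] ballI conjI)
    show "(\<lambda>\<omega>. Q (\<Theta> \<omega>)) \<in> M \<rightarrow>\<^sub>M prob_algebra M" by (rule measurable_compose[OF \<Theta> Q_meas])
    fix B assume "B \<in> sets N"
    then have A: "X -` B \<inter> space M \<in> sets M" by (rule measurable_sets[OF X])
    show "(\<lambda>\<omega>. measure (Q (\<Theta> \<omega>)) (X -` B \<inter> space M)) \<in> borel_measurable (gen_by M \<Theta> T)"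
      by (rule measurable_compose[OF \<Theta>_gen cond_prob_given_measurable[OF Q A]])
    show "disintegrates M (sets (gen_by M \<Theta> T)) (X -` B \<inter> space M)
        (\<lambda>\<omega>. measure (Q (\<Theta> \<omega>)) (X -` B \<inter> space M))"
      by (rule cond_prob_given_disintegrates[OF Q \<Theta> A])
  qed
qed

text \<open>An event that is null for every \<open>Q \<theta>\<close> is null: its probability is an average over the parameter.\<close>

lemma (in prob_space) minimal_sufficient_subset_null_closure:
  assumes min: "minimal_sufficient M N X T \<Theta> S" and C: "sufficient M N X T \<Theta> C"
    and \<Theta>: "\<Theta> \<in> M \<rightarrow>\<^sub>M T"
  shows "sets S \<subseteq> null_closure M C"
proof
  fix A assume A: "A \<in> sets S"
  obtain B Q where B: "B \<in> sets C" and Q: "cond_prob_given M T \<Theta> Q"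
    and zero: "\<And>\<theta>. \<theta> \<in> space T \<Longrightarrow> measure (Q \<theta>) (sym_diff A B) = 0"
    using min C A unfolding minimal_sufficient_def by meson
  have S: "subalgebra M S" using min by (simp add: minimal_sufficient_def sufficient_def)
  have CM: "subalgebra M C" using C by (simp add: sufficient_def)
  have AM: "A \<in> sets M" and BM: "B \<in> sets M" using A B S CM by (auto simp: subalgebra_def)
  have D: "sym_diff A B \<in> sets M" using AM BM by auto
  have "emeasure M (sym_diff A B) = (\<integral>\<^sup>+\<omega>. ennreal (measure (Q (\<Theta> \<omega>)) (sym_diff A B)) \<partial>M)"
    by (rule cond_prob_given_total_probability[OF Q \<Theta> D, symmetric])
  also have "\<dots> = (\<integral>\<^sup>+\<omega>. 0 \<partial>M)"
    by (rule nn_integral_cong) (simp add: zero measurable_space[OF \<Theta>])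
  finally have "sym_diff A B \<in> null_sets M"
    using D by (intro null_setsI) simp_all
  then have "AE \<omega> in M. \<omega> \<notin> sym_diff A B" by (rule AE_not_in)
  then have "AE \<omega> in M. \<omega> \<in> A \<longleftrightarrow> \<omega> \<in> B" by eventually_elim auto
  then show "A \<in> null_closure M C" by (rule null_closureI[OF AM B])
qed

text \<open>On the parameters for which \<open>Q\<close> charges the null set \<open>N\<close>, the kernel is replaced by its value at a
  parameter where it does not. Such a parameter exists because almost every one qualifies, and for
  the same reason the result is again a version.\<close>

lemma (in prob_space) cond_prob_given_vanishing_version:
  assumes Q: "cond_prob_given M T \<Theta> Q" and \<Theta>: "\<Theta> \<in> M \<rightarrow>\<^sub>M T" and N: "N \<in> null_sets M"
  obtains Q' where "cond_prob_given M T \<Theta> Q'" "\<And>\<theta>. \<theta> \<in> space T \<Longrightarrow> measure (Q' \<theta>) N = 0"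
proof -
  have NM: "N \<in> sets M" using N by blast
  have Q_meas: "Q \<in> T \<rightarrow>\<^sub>M prob_algebra M" using Q unfolding cond_prob_given_def by blast
  note QN = cond_prob_given_measurable[OF Q NM]
  have null: "AE \<omega> in M. measure (Q (\<Theta> \<omega>)) N = 0"
  proof -
    have "(\<integral>\<^sup>+\<omega>. ennreal (measure (Q (\<Theta> \<omega>)) N) \<partial>M) = 0"
      using cond_prob_given_total_probability[OF Q \<Theta> NM] N by (simp add: null_setsD1)
    then have "AE \<omega> in M. ennreal (measure (Q (\<Theta> \<omega>)) N) = 0"
      by (subst (asm) nn_integral_0_iff_AE) (use measurable_compose[OF \<Theta> QN] in auto)
    then show ?thesis by eventually_elim simp
  qed
  have "\<exists>\<omega>\<in>space M. measure (Q (\<Theta> \<omega>)) N = 0"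
  proof (rule ccontr)
    assume "\<not> ?thesis"
    then have "AE \<omega> in M. measure (Q (\<Theta> \<omega>)) N \<noteq> 0" by (intro AE_I2) blast
    with null have "AE \<omega> in M. False" by eventually_elim simp
    then show False by simp
  qed
  then obtain \<omega>\<^sub>0 where \<omega>\<^sub>0: "\<omega>\<^sub>0 \<in> space M" "measure (Q (\<Theta> \<omega>\<^sub>0)) N = 0" by blast
  define Q' where "Q' \<theta> = (if measure (Q \<theta>) N = 0 then Q \<theta> else Q (\<Theta> \<omega>\<^sub>0))" for \<theta>
  show thesis
  proof (rule that)
    show "cond_prob_given M T \<Theta> Q'"
      unfolding cond_prob_given_def
    proof (intro conjI ballI)
      have "{\<theta> \<in> space T. measure (Q \<theta>) N = 0} \<in> sets T"
        using QN by measurable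
      then show "Q' \<in> T \<rightarrow>\<^sub>M prob_algebra M"
        unfolding Q'_def
        by (intro measurable_If Q_meas measurable_const)
           (use measurable_space[OF Q_meas] measurable_space[OF \<Theta>] \<omega>\<^sub>0 in simp_all)
      fix A assume "A \<in> sets M"
      then have "AE \<omega> in M. measure (Q (\<Theta> \<omega>)) A = cond_prob_on M (gen_by M \<Theta> T) A \<omega>"
        using Q unfolding cond_prob_given_def by blast
      with null show "AE \<omega> in M. measure (Q' (\<Theta> \<omega>)) A = cond_prob_on M (gen_by M \<Theta> T) A \<omega>"
        by eventually_elim (simp add: Q'_def)
    qed
    show "measure (Q' \<theta>) N = 0" for \<theta>
      using \<omega>\<^sub>0 by (simp add: Q'_def)
  qed
qed

lemma (in prob_space) minimal_sufficientI:
  assumes suff: "sufficient M N X T \<Theta> S" and Q: "cond_prob_given M T \<Theta> Q" and \<Theta>: "\<Theta> \<in> M \<rightarrow>\<^sub>M T"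
    and min: "\<And>C. sufficient M N X T \<Theta> C \<Longrightarrow> sets S \<subseteq> null_closure M C"
  shows "minimal_sufficient M N X T \<Theta> S"
  unfolding minimal_sufficient_def
proof (intro conjI suff allI impI ballI)
  fix C A assume C: "sufficient M N X T \<Theta> C" and A: "A \<in> sets S"
  obtain B where AM: "A \<in> sets M" and B: "B \<in> sets C" and AB: "AE \<omega> in M. \<omega> \<in> A \<longleftrightarrow> \<omega> \<in> B"
    using min[OF C] A unfolding null_closure_def by blast
  have "B \<in> sets M" using C B by (auto simp: sufficient_def subalgebra_def)
  then have "sym_diff A B \<in> null_sets M"
    using AM AB by (subst AE_iff_null_sets) (auto elim: eventually_mono)
  then obtain Q' where "cond_prob_given M T \<Theta> Q'" "\<And>\<theta>. \<theta> \<in> space T \<Longrightarrow> measure (Q' \<theta>) (sym_diff A B) = 0"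
    using cond_prob_given_vanishing_version[OF Q \<Theta>] by blast
  with B show "\<exists>B\<in>sets C. \<exists>Q. cond_prob_given M T \<Theta> Q \<and> (\<forall>\<theta>\<in>space T. measure (Q \<theta>) (sym_diff A B) = 0)"
    by blast
qed

text \<open>The definition of minimality is applied to \<open>S\<close> itself and the empty event.\<close>

lemma (in prob_space) minimal_sufficient_cond_prob_given:
  assumes "minimal_sufficient M N X T \<Theta> S"
  obtains Q where "cond_prob_given M T \<Theta> Q"
proof -
  have "sufficient M N X T \<Theta> S" using assms by (simp add: minimal_sufficient_def)
  then have "\<exists>C\<in>sets S. \<exists>Q. cond_prob_given M T \<Theta> Q \<and> (\<forall>\<theta>\<in>space T. measure (Q \<theta>) (sym_diff {} C) = 0)"
    using assms sets.empty_sets[of S] unfolding minimal_sufficient_def by meson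
  then show thesis using that by blast
qed

section \<open>The projective limit model\<close>

lemma parametrized_model_measurable:
  assumes "parametrized_model M X\<^sub>t X T \<Theta> p"
  shows "X \<in> M \<rightarrow>\<^sub>M borel_of X\<^sub>t" "\<Theta> \<in> M \<rightarrow>\<^sub>M T"
proof -
  let ?N = "borel_of X\<^sub>t"
  obtain Xs F \<psi> where ex: "exchangeable M ?N Xs" and X: "X = Xs 0"
    and F: "limiting_empirical_map X\<^sub>t F"
    and \<psi>: "bimeasurable_onto
        (restrict_space (prob_algebra ?N) ((\<lambda>\<omega>. F (\<lambda>n. Xs n \<omega>)) ` space M)) T \<psi>"
    and \<Theta>: "\<And>\<omega>. \<omega> \<in> space M \<Longrightarrow> \<Theta> \<omega> = \<psi> (F (\<lambda>n. Xs n \<omega>))"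
    using assms unfolding parametrized_model_def by blast
  have Xs: "Xs n \<in> M \<rightarrow>\<^sub>M ?N" for n using ex unfolding exchangeable_def by blast
  show "X \<in> M \<rightarrow>\<^sub>M ?N" unfolding X by (rule Xs)
  have seq: "(\<lambda>\<omega> n. Xs n \<omega>) \<in> M \<rightarrow>\<^sub>M (\<Pi>\<^sub>M n\<in>UNIV. ?N)"
  proof (rule measurable_PiM_single')
    show "(\<lambda>\<omega>. Xs n \<omega>) \<in> M \<rightarrow>\<^sub>M ?N" for n by (rule Xs)
    show "(\<lambda>\<omega> n. Xs n \<omega>) \<in> space M \<rightarrow> (\<Pi>\<^sub>E n\<in>UNIV. space ?N)"
      by (intro funcsetI PiE_I measurable_space[OF Xs]) simp_all
  qed
  have F_meas: "F \<in> (\<Pi>\<^sub>M n\<in>(UNIV :: nat set). ?N) \<rightarrow>\<^sub>M prob_algebra ?N"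
    using F unfolding limiting_empirical_map_def by blast
  have "(\<lambda>\<omega>. F (\<lambda>n. Xs n \<omega>)) \<in>
      M \<rightarrow>\<^sub>M restrict_space (prob_algebra ?N) ((\<lambda>\<omega>. F (\<lambda>n. Xs n \<omega>)) ` space M)"
    by (rule measurable_restrict_space2[OF _ measurable_compose[OF seq F_meas]]) blast
  moreover have "\<psi> \<in> restrict_space (prob_algebra ?N) ((\<lambda>\<omega>. F (\<lambda>n. Xs n \<omega>)) ` space M) \<rightarrow>\<^sub>M T"
    using \<psi> unfolding bimeasurable_onto_def by blast
  ultimately have "(\<lambda>\<omega>. \<psi> (F (\<lambda>n. Xs n \<omega>))) \<in> M \<rightarrow>\<^sub>M T"
    by (rule measurable_compose)
  then show "\<Theta> \<in> M \<rightarrow>\<^sub>M T"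
    by (subst measurable_cong[OF \<Theta>])
qed

context projective_limit_model
begin

abbreviation "XD \<equiv> proj_lim_var D X"
abbreviation "\<Theta>D \<equiv> proj_lim_var D \<Theta>"
abbreviation "param_algebra I \<equiv> gen_by M (\<Theta> I) (borel_of (TS I))"
abbreviation "limit_param_algebra \<equiv> gen_by M \<Theta>D (proj_lim D TS g)"

lemma X_measurable: "I \<in> D \<Longrightarrow> X I \<in> M \<rightarrow>\<^sub>M borel_of (XS I)"
  and \<Theta>_measurable: "I \<in> D \<Longrightarrow> \<Theta> I \<in> M \<rightarrow>\<^sub>M borel_of (TS I)"
  using parametrized_model_measurable[OF model] by blast+

lemma XD_measurable: "XD \<in> M \<rightarrow>\<^sub>M proj_lim D XS f"
  by (rule obs.proj_lim_var_measurable[OF X_measurable X_projective])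

lemma \<Theta>D_measurable: "\<Theta>D \<in> M \<rightarrow>\<^sub>M proj_lim D TS g"
  by (rule par.proj_lim_var_measurable[OF \<Theta>_measurable \<Theta>_projective])

lemma param_algebra_mono:
  assumes "I \<in> D" "J \<in> D" "I \<le> J"
  shows "sets (param_algebra I) \<subseteq> sets (param_algebra J)"
  by (rule gen_by_subset[OF continuous_map_measurable_borel_of[OF par.f_continuous[OF assms]]
        \<Theta>_measurable[OF assms(2)] \<Theta>_projective[OF assms]])

lemma param_algebra_subset_limit:
  assumes "I \<in> D"
  shows "sets (param_algebra I) \<subseteq> sets limit_param_algebra"
  by (rule gen_by_subset[OF measurable_proj_lim_coordinate[OF assms] \<Theta>D_measurable])
     (simp add: proj_lim_var_def assms)

text \<open>The limit parameter is measurable for any \<open>\<sigma>\<close>-algebra for which all of its coordinates are.\<close>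

lemma limit_param_algebra_generated:
  "sets limit_param_algebra \<subseteq> sigma_sets (space M) (\<Union>I\<in>D. sets (param_algebra I))"
proof -
  have \<E>: "(\<Union>I\<in>D. sets (param_algebra I)) \<subseteq> sets M"
    using subalgebra_gen_by[OF \<Theta>_measurable] unfolding subalgebra_def by blast
  let ?G = "sigma (space M) (\<Union>I\<in>D. sets (param_algebra I))"
  have sp: "space ?G = space M" using subalgebra_sigma(1)[OF \<E>] by (simp add: subalgebra_def)
  have "\<Theta>D \<in> ?G \<rightarrow>\<^sub>M proj_lim D TS g"
  proof (rule par.proj_lim_var_measurable)
    show "\<Theta> I \<in> ?G \<rightarrow>\<^sub>M borel_of (TS I)" if I: "I \<in> D" for I
    proof (rule measurableI)
      show "\<Theta> I \<omega> \<in> space (borel_of (TS I))" if "\<omega> \<in> space ?G" for \<omega>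
        using that sp measurable_space[OF \<Theta>_measurable[OF I]] by blast
      fix B assume B: "B \<in> sets (borel_of (TS I))"
      have "\<Theta> I -` B \<inter> space M \<in> sets (param_algebra I)" using B by (rule in_vimage_algebra)
      then have "\<Theta> I -` B \<inter> space M \<in> sigma_sets (space M) (\<Union>I\<in>D. sets (param_algebra I))"
        using I by (intro sigma_sets.Basic) blast
      then show "\<Theta> I -` B \<inter> space ?G \<in> sets ?G" unfolding sp subalgebra_sigma(2)[OF \<E>] .
    qed
    show "\<Theta> I \<omega> = g J I (\<Theta> J \<omega>)" if "I \<in> D" "J \<in> D" "I \<le> J" "\<omega> \<in> space ?G" for I J \<omega>
      using \<Theta>_projective that sp by blast
  qed
  then have "sets limit_param_algebra \<subseteq> sets ?G" by (rule sets_image_in_sets[OF sp])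
  then show ?thesis unfolding subalgebra_sigma(2)[OF \<E>] .
qed

text \<open>Both sides are values of the kernels \<open>P K\<close> and \<open>P I\<close> on the same event, expressed through \<open>X K\<close> on the
  left.\<close>

lemma cond_prob_on_param_algebra_projective:
  assumes I: "I \<in> D" and K: "K \<in> D" and le: "I \<le> K" and B: "B \<in> sets (borel_of (XS I))"
  shows "AE \<omega> in M. cond_prob_on M (param_algebra K) (X I -` B \<inter> space M) \<omega>
    = cond_prob_on M (param_algebra I) (X I -` B \<inter> space M) \<omega>"
proof -
  have law: "regular_cond_law M (borel_of (XS J)) (X J) (borel_of (TS J)) (\<Theta> J) (P J)" if "J \<in> D" for J
    using model[OF that] by (simp add: parametrized_model_def)
  have f_meas: "f K I \<in> borel_of (XS K) \<rightarrow>\<^sub>M borel_of (XS I)"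
    by (rule continuous_map_measurable_borel_of[OF obs.f_continuous[OF I K le]])
  let ?B = "f K I -` B \<inter> topspace (XS K)"
  have B': "?B \<in> sets (borel_of (XS K))" using measurable_sets[OF f_meas B] by simp
  have eq: "X K -` ?B \<inter> space M = X I -` B \<inter> space M"
    using measurable_space[OF X_measurable[OF K]] X_projective[OF I K le] by auto
  have "AE \<omega> in M. measure (P I \<omega>) B = cond_prob_on M (param_algebra I) (X I -` B \<inter> space M) \<omega>"
    using law[OF I] B unfolding regular_cond_law_def by blast
  moreover have "AE \<omega> in M. measure (P K \<omega>) ?B = cond_prob_on M (param_algebra K) (X I -` B \<inter> space M) \<omega>"
    using law[OF K] B' unfolding regular_cond_law_def eq[symmetric] by blast
  moreover note P_projective[OF I K le] AE_space
  ultimately show ?thesis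
  proof eventually_elim
    case (elim \<omega>)
    have "P K \<in> param_algebra K \<rightarrow>\<^sub>M prob_algebra (borel_of (XS K))"
      using law[OF K] unfolding regular_cond_law_def by blast
    from measurable_space[OF this, of \<omega>] have s: "sets (P K \<omega>) = sets (borel_of (XS K))"
      using elim(4) by (simp add: space_prob_algebra)
    then have "f K I \<in> P K \<omega> \<rightarrow>\<^sub>M borel_of (XS I)"
      using f_meas by (simp cong: measurable_cong_sets)
    then have "measure (distr (P K \<omega>) (borel_of (XS I)) (f K I)) B = measure (P K \<omega>) ?B"
      using B sets_eq_imp_space_eq[OF s] by (simp add: measure_distr)
    then show ?case using elim(1-3) by simp
  qed
qed

text \<open>Every event of the union of the \<open>\<sigma>(\<Theta> J)\<close> lies in some \<open>\<sigma>(\<Theta> K)\<close> with \<open>I \<le> K\<close>, where the conditional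
  probability is the same as for \<open>I\<close>. The union is stable under intersections because the index set is
  directed, so that its events determine the integrals over all events of \<open>\<sigma>(\<Theta>D)\<close>.\<close>

lemma cylinder_cond_prob_disintegrates:
  assumes I: "I \<in> D" and B: "B \<in> sets (borel_of (XS I))"
  shows "disintegrates M (sets limit_param_algebra) (X I -` B \<inter> space M)
    (cond_prob_on M (param_algebra I) (X I -` B \<inter> space M))"
proof -
  let ?A = "X I -` B \<inter> space M" and ?\<E> = "\<Union>J\<in>D. sets (param_algebra J)"
  have A: "?A \<in> sets M" by (rule measurable_sets[OF X_measurable[OF I] B])
  have sub: "subalgebra M (param_algebra J)" if "J \<in> D" for J
    by (rule subalgebra_gen_by[OF \<Theta>_measurable[OF that]])
  have "disintegrates M ?\<E> ?A (cond_prob_on M (param_algebra I) ?A)"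
    unfolding disintegrates_def
  proof
    fix E assume "E \<in> ?\<E>"
    then obtain J where J: "J \<in> D" "E \<in> sets (param_algebra J)" by blast
    obtain K where K: "K \<in> D" "I \<le> K" "J \<le> K" using obs.D_directed[OF I J(1)] by blast
    have "disintegrates M (sets (param_algebra K)) ?A (cond_prob_on M (param_algebra I) ?A)"
      using cond_prob_on_disintegrates[OF sub[OF K(1)] A]
      by (simp only: disintegrates_cong_AE[OF cond_prob_on_param_algebra_projective[OF I K(1,2) B]])
    moreover have "E \<in> sets (param_algebra K)"
      using param_algebra_mono[OF J(1) K(1,3)] J(2) by blast
    ultimately show "(\<integral>\<^sup>+\<omega>\<in>E. ennreal (cond_prob_on M (param_algebra I) ?A \<omega>) \<partial>M) = emeasure M (?A \<inter> E)"
      unfolding disintegrates_def by blast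
  qed
  moreover have "Int_stable ?\<E>"
  proof (rule Int_stableI)
    fix a b assume "a \<in> ?\<E>" "b \<in> ?\<E>"
    then obtain J J' where J: "J \<in> D" "a \<in> sets (param_algebra J)" "J' \<in> D" "b \<in> sets (param_algebra J')"
      by blast
    obtain K where K: "K \<in> D" "J \<le> K" "J' \<le> K" using obs.D_directed[OF J(1,3)] by blast
    have "a \<in> sets (param_algebra K)" "b \<in> sets (param_algebra K)"
      using param_algebra_mono[OF J(1) K(1,2)] param_algebra_mono[OF J(3) K(1,3)] J by blast+
    then have "a \<inter> b \<in> sets (param_algebra K)" by (rule sets.Int)
    then show "a \<inter> b \<in> ?\<E>" using K(1) by blast
  qed
  moreover have "?\<E> \<subseteq> sets M" using sub unfolding subalgebra_def by blast
  moreover have "space M \<in> ?\<E>" using I sets.top[of "param_algebra I"] by auto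
  moreover have "cond_prob_on M (param_algebra I) ?A \<in> borel_measurable M"
    by (rule measurable_from_subalg[OF sub[OF I]]) (simp add: cond_prob_on_def)
  ultimately have "disintegrates M (sigma_sets (space M) ?\<E>) ?A (cond_prob_on M (param_algebra I) ?A)"
    using A by (intro disintegrates_sigma_sets)
  then show ?thesis using limit_param_algebra_generated by (rule disintegrates_subset)
qed

text \<open>The \<open>\<sigma>\<close>-algebra of the parameter is one of the sufficient competitors of \<open>S\<close>.\<close>

lemma minimal_sufficient_subset_param_algebra:
  assumes I: "I \<in> D" and min: "minimal_sufficient M (borel_of (XS I)) (X I) (borel_of (TS I)) (\<Theta> I) S"
  shows "sets S \<subseteq> null_closure M (param_algebra I)"
proof -
  obtain Q where "cond_prob_given M (borel_of (TS I)) (\<Theta> I) Q"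
    by (rule minimal_sufficient_cond_prob_given[OF min])
  then have "sufficient M (borel_of (XS I)) (X I) (borel_of (TS I)) (\<Theta> I) (param_algebra I)"
    by (rule gen_by_sufficient[OF _ \<Theta>_measurable[OF I] X_measurable[OF I]])
  then show ?thesis
    by (rule minimal_sufficient_subset_null_closure[OF min _ \<Theta>_measurable[OF I]])
qed

text \<open>As \<open>S\<close> lies below \<open>\<sigma>(\<Theta> I)\<close> up to null sets, the \<open>S\<close>-measurable conditional probability given
  \<open>\<sigma>(\<Theta> I) \<or> S\<close>, which sufficiency provides, is a version of the one given \<open>\<sigma>(\<Theta> I)\<close>.\<close>

lemma cylinder_cond_prob_version:
  assumes I: "I \<in> D" and min: "minimal_sufficient M (borel_of (XS I)) (X I) (borel_of (TS I)) (\<Theta> I) S"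
    and B: "B \<in> sets (borel_of (XS I))"
  obtains h where "h \<in> borel_measurable S" "\<And>\<omega>. 0 \<le> h \<omega>"
    "disintegrates M (sets limit_param_algebra) (X I -` B \<inter> space M) h"
proof -
  let ?A = "X I -` B \<inter> space M" and ?G = "param_algebra I"
  let ?J = "sigma_sets (space M) (sets ?G \<union> sets S)"
  have suff: "sufficient M (borel_of (XS I)) (X I) (borel_of (TS I)) (\<Theta> I) S"
    using min by (simp add: minimal_sufficient_def)
  then obtain k where S: "subalgebra M S"
    and h: "(\<lambda>\<omega>. measure (k \<omega>) ?A) \<in> borel_measurable S"
    and dis: "disintegrates M ?J ?A (\<lambda>\<omega>. measure (k \<omega>) ?A)"
    using B unfolding sufficient_iff_disintegrates[OF \<Theta>_measurable[OF I] X_measurable[OF I]] by blast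
  have A: "?A \<in> sets M" by (rule measurable_sets[OF X_measurable[OF I] B])
  have G: "subalgebra M ?G" by (rule subalgebra_gen_by[OF \<Theta>_measurable[OF I]])
  have un: "sets ?G \<union> sets S \<subseteq> sets M" using G S by (simp add: subalgebra_def)
  note J = subalgebra_sigma[OF un]
  have sp: "space (sigma (space M) (sets ?G \<union> sets S)) = space M"
    using J(1) by (simp add: subalgebra_def)
  have S_J: "subalgebra (sigma (space M) (sets ?G \<union> sets S)) S"
    using S sp unfolding subalgebra_def J(2) by (auto intro: sigma_sets.Basic)
  have G_J: "subalgebra (sigma (space M) (sets ?G \<union> sets S)) ?G"
    using sp unfolding subalgebra_def J(2) by (auto intro: sigma_sets.Basic)
  have "?J \<subseteq> null_closure M ?G"
    using sets_subset_null_closure[OF G] minimal_sufficient_subset_param_algebra[OF I min]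
    by (intro sigma_sets_subset_null_closure[OF G] Un_least)
  then have dis_G: "disintegrates M ?J ?A (cond_prob_on M ?G ?A)"
    by (rule disintegrates_subset[OF disintegrates_null_closure[OF G A cond_prob_on_disintegrates[OF G A]]])
  have "AE \<omega> in M. cond_prob_on M (sigma (space M) (sets ?G \<union> sets S)) ?A \<omega> = measure (k \<omega>) ?A"
    by (rule AE_cond_prob_on_eqI[OF J(1) A measurable_from_subalg[OF S_J h]])
       (use dis J(2) in simp_all)
  moreover have "AE \<omega> in M. cond_prob_on M (sigma (space M) (sets ?G \<union> sets S)) ?A \<omega> = cond_prob_on M ?G ?A \<omega>"
  proof (rule AE_cond_prob_on_eqI[OF J(1) A measurable_from_subalg[OF G_J]])
    show "cond_prob_on M ?G ?A \<in> borel_measurable ?G" by (simp add: cond_prob_on_def)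
    show "AE \<omega> in M. 0 \<le> cond_prob_on M ?G ?A \<omega>" by (rule cond_prob_on_nonneg[OF G A])
  qed (use dis_G J(2) in simp)
  ultimately have "AE \<omega> in M. cond_prob_on M ?G ?A \<omega> = measure (k \<omega>) ?A"
    by eventually_elim simp
  then have "disintegrates M (sets limit_param_algebra) ?A (\<lambda>\<omega>. measure (k \<omega>) ?A)"
    using cylinder_cond_prob_disintegrates[OF I B] by (simp only: disintegrates_cong_AE)
  with h show thesis by (intro that) simp_all
qed

text \<open>Up to null sets, \<open>\<sigma>(\<Theta>D) \<or> \<S>\<^sub>D\<close> is \<open>\<sigma>(\<Theta>D)\<close>. Averaging \<open>Q\<close> over the conditional law of \<open>\<Theta>D\<close> given
  \<open>\<S>\<^sub>D\<close> yields a kernel that is right for test events in \<open>\<S>\<^sub>D\<close> and all \<open>A\<close>. For a cylinder event \<open>A\<close> it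
  agrees almost surely with the \<open>\<S>\<^sub>D\<close>-measurable version of the conditional probability given \<open>\<sigma>(\<Theta>D)\<close>, and
  is therefore right for all test events. For a fixed test event, both sides are finite measures
  in the observed set, so that equality on cylinders suffices.\<close>

lemma limit_sufficient:
  assumes Q: "cond_prob_given M (proj_lim D TS g) \<Theta>D Q"
    and min: "\<And>I. I \<in> D \<Longrightarrow> minimal_sufficient M (borel_of (XS I)) (X I) (borel_of (TS I)) (\<Theta> I) (S I)"
  shows "sufficient M (proj_lim D XS f) XD (proj_lim D TS g) \<Theta>D (sigma (space M) (\<Union>I\<in>D. sets (S I)))"
proof -
  let ?SD = "sigma (space M) (\<Union>I\<in>D. sets (S I))" and ?G = limit_param_algebra
  let ?J = "sigma_sets (space M) (sets ?G \<union> sets ?SD)"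
  have S: "subalgebra M (S I)" if "I \<in> D" for I
    using min[OF that] by (simp add: minimal_sufficient_def sufficient_def)
  have un: "(\<Union>I\<in>D. sets (S I)) \<subseteq> sets M" using S unfolding subalgebra_def by blast
  note SD = subalgebra_sigma[OF un]
  have S_SD: "subalgebra ?SD (S I)" if "I \<in> D" for I
  proof -
    have "sets (S I) \<subseteq> sets ?SD" unfolding SD(2) using that by (blast intro: sigma_sets.Basic)
    moreover have "space (S I) = space ?SD" using S[OF that] SD(1) by (simp add: subalgebra_def)
    ultimately show ?thesis by (simp only: subalgebra_def)
  qed
  have G: "subalgebra M ?G" by (rule subalgebra_gen_by[OF \<Theta>D_measurable])
  have SD_G: "sets ?SD \<subseteq> null_closure M ?G"
    unfolding SD(2)
  proof (rule sigma_sets_subset_null_closure[OF G], rule UN_least)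
    fix I assume I: "I \<in> D"
    show "sets (S I) \<subseteq> null_closure M ?G"
      using minimal_sufficient_subset_param_algebra[OF I min[OF I]]
        null_closure_mono[OF param_algebra_subset_limit[OF I]] by (rule subset_trans)
  qed
  then have J_G: "?J \<subseteq> null_closure M ?G"
    using sets_subset_null_closure[OF G] by (intro sigma_sets_subset_null_closure[OF G] Un_least)
  have Q_meas: "Q \<in> proj_lim D TS g \<rightarrow>\<^sub>M prob_algebra M" using Q unfolding cond_prob_given_def by blast
  obtain \<omega> where "\<omega> \<in> space M" using not_empty by blast
  then have "proj_lim_set D TS g \<noteq> {}" using measurable_space[OF \<Theta>D_measurable] by force
  then have "measurable_retract (proj_lim D TS g) baire_space" by (rule par.proj_lim_measurable_retract)
  from averaged_kernel[OF SD(1) \<Theta>D_measurable this Q_meas]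
  obtain k where k: "k \<in> ?SD \<rightarrow>\<^sub>M prob_algebra M"
    and k_avg: "\<And>E A. E \<in> sets ?SD \<Longrightarrow> A \<in> sets M \<Longrightarrow>
      (\<integral>\<^sup>+\<omega>\<in>E. emeasure (k \<omega>) A \<partial>M) = (\<integral>\<^sup>+\<omega>\<in>E. emeasure (Q (\<Theta>D \<omega>)) A \<partial>M)"
    by blast
  have kM: "k \<in> M \<rightarrow>\<^sub>M prob_algebra M" by (rule measurable_from_subalg[OF SD(1) k])
  have QM: "(\<lambda>\<omega>. Q (\<Theta>D \<omega>)) \<in> M \<rightarrow>\<^sub>M prob_algebra M" by (rule measurable_compose[OF \<Theta>D_measurable Q_meas])
  have k_int: "(\<integral>\<^sup>+\<omega>\<in>E. emeasure (k \<omega>) A \<partial>M) = (\<integral>\<^sup>+\<omega>\<in>E. ennreal (measure (k \<omega>) A) \<partial>M)" for E A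
    by (rule nn_integral_cong) (simp add: emeasure_kernel_eq_measure[OF kM])
  have Q_int: "(\<integral>\<^sup>+\<omega>\<in>E. emeasure (Q (\<Theta>D \<omega>)) A \<partial>M) = (\<integral>\<^sup>+\<omega>\<in>E. ennreal (measure (Q (\<Theta>D \<omega>)) A) \<partial>M)" for E A
    by (rule nn_integral_cong) (simp add: emeasure_kernel_eq_measure[OF QM])
  have k_meas: "(\<lambda>\<omega>. measure (k \<omega>) A) \<in> borel_measurable ?SD" if "A \<in> sets M" for A
    by (rule measurable_compose[OF k measurable_measure_prob_algebra[OF that]])

  have k_SD: "disintegrates M (sets ?SD) A (\<lambda>\<omega>. measure (k \<omega>) A)" if A: "A \<in> sets M" for A
  proof -
    have "disintegrates M (sets ?SD) A (\<lambda>\<omega>. measure (Q (\<Theta>D \<omega>)) A)"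
      using disintegrates_null_closure[OF G A cond_prob_given_disintegrates[OF Q \<Theta>D_measurable A]] SD_G
      by (rule disintegrates_subset)
    then show ?thesis
      unfolding disintegrates_def using k_avg[OF _ A] by (simp add: k_int Q_int)
  qed

  \<comment> \<open>Both \<open>h\<close> and the kernel are versions of the conditional probability given \<open>\<S>\<^sub>D\<close>, hence equal almost surely;\<close>
  \<comment> \<open>the test events are thereby extended from those of \<open>\<S>\<^sub>D\<close> to those of \<open>\<sigma>(\<Theta>D) \<or> \<S>\<^sub>D\<close>.\<close>
  have cyl: "disintegrates M ?J (X I -` B \<inter> space M) (\<lambda>\<omega>. measure (k \<omega>) (X I -` B \<inter> space M))"
    if I: "I \<in> D" and B: "B \<in> sets (borel_of (XS I))" for I B
  proof -
    let ?A = "X I -` B \<inter> space M"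
    have A: "?A \<in> sets M" by (rule measurable_sets[OF X_measurable[OF I] B])
    obtain h where h: "h \<in> borel_measurable (S I)" "\<And>\<omega>. 0 \<le> h \<omega>"
      and h_G: "disintegrates M (sets ?G) ?A h"
      using cylinder_cond_prob_version[OF I min[OF I] B] by blast
    note h_null = disintegrates_null_closure[OF G A h_G]
    have "AE \<omega> in M. cond_prob_on M ?SD ?A \<omega> = h \<omega>"
      using h(2) by (intro AE_cond_prob_on_eqI[OF SD(1) A measurable_from_subalg[OF S_SD[OF I] h(1)]]
          disintegrates_subset[OF h_null SD_G] AE_I2)
    moreover have "AE \<omega> in M. cond_prob_on M ?SD ?A \<omega> = measure (k \<omega>) ?A"
      by (intro AE_cond_prob_on_eqI[OF SD(1) A k_meas[OF A]] k_SD[OF A] AE_I2 measure_nonneg)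
    ultimately have "AE \<omega> in M. h \<omega> = measure (k \<omega>) ?A" by eventually_elim simp
    then show ?thesis
      using disintegrates_subset[OF h_null J_G] by (simp only: disintegrates_cong_AE)
  qed

  have main: "disintegrates M ?J (XD -` B \<inter> space M) (\<lambda>\<omega>. measure (k \<omega>) (XD -` B \<inter> space M))"
    if B: "B \<in> sets (proj_lim D XS f)" for B
    unfolding disintegrates_def
  proof
    fix E assume E: "E \<in> ?J"
    have "sets ?G \<union> sets ?SD \<subseteq> sets M" using G SD(1) by (simp add: subalgebra_def)
    then have EM: "E \<in> sets M" using E sets.sigma_sets_subset by blast
    let ?\<C> = "{(\<lambda>x. x I) -` B \<inter> proj_lim_set D XS f | I B. I \<in> D \<and> B \<in> sets (borel_of (XS I))}"
    let ?m = "density M (indicator E)"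
    let ?\<mu> = "distr ?m (proj_lim D XS f) XD" and ?\<mu>' = "distr (?m \<bind> k) (proj_lim D XS f) XD"
    have k': "k \<in> ?m \<rightarrow>\<^sub>M subprob_algebra M" using measurable_prob_algebraD[OF kM] by simp
    have sets_bind: "sets (?m \<bind> k) = sets M"
      by (rule sets_bind[OF sets_kernel[OF k']]) (use not_empty in simp_all)
    have XD': "XD \<in> (?m \<bind> k) \<rightarrow>\<^sub>M proj_lim D XS f"
      using XD_measurable sets_bind by (simp cong: measurable_cong_sets)
    have \<mu>: "emeasure ?\<mu> B = emeasure M ((XD -` B \<inter> space M) \<inter> E)"
      if "B \<in> sets (proj_lim D XS f)" for B
      using that XD_measurable EM measurable_sets[OF XD_measurable that]
      by (simp add: emeasure_distr emeasure_density indicator_inter_arith[symmetric] Int_commute)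
    have \<mu>': "emeasure ?\<mu>' B = (\<integral>\<^sup>+\<omega>\<in>E. ennreal (measure (k \<omega>) (XD -` B \<inter> space M)) \<partial>M)"
      if "B \<in> sets (proj_lim D XS f)" for B
    proof -
      note A = measurable_sets[OF XD_measurable that]
      have "emeasure ?\<mu>' B = emeasure (?m \<bind> k) (XD -` B \<inter> space M)"
        using emeasure_distr[OF XD' that] sets_eq_imp_space_eq[OF sets_bind] by simp
      also have "\<dots> = (\<integral>\<^sup>+\<omega>. emeasure (k \<omega>) (XD -` B \<inter> space M) \<partial>?m)"
        by (rule emeasure_bind[OF _ k' A]) (simp add: not_empty)
      also have "\<dots> = (\<integral>\<^sup>+\<omega>\<in>E. emeasure (k \<omega>) (XD -` B \<inter> space M) \<partial>M)"
        by (subst nn_integral_density)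
           (use EM measurable_compose[OF measurable_prob_algebraD[OF kM] measurable_emeasure_subprob_algebra[OF A]]
             in \<open>simp_all add: mult.commute\<close>)
      finally show ?thesis unfolding k_int .
    qed
    have cyl_sets: "?\<C> \<subseteq> sets (proj_lim D XS f)" unfolding sets_proj_lim by blast
    have eq: "emeasure ?\<mu> C = emeasure ?\<mu>' C" if C: "C \<in> ?\<C>" for C
    proof -
      obtain I B where I: "I \<in> D" and B: "B \<in> sets (borel_of (XS I))"
        and CB: "C = (\<lambda>x. x I) -` B \<inter> proj_lim_set D XS f" using C by blast
      have "XD -` C \<inter> space M = X I -` B \<inter> space M"
        unfolding CB by (rule proj_lim_var_vimage[OF I XD_measurable])
      then have "(\<integral>\<^sup>+\<omega>\<in>E. ennreal (measure (k \<omega>) (XD -` C \<inter> space M)) \<partial>M)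
          = emeasure M ((XD -` C \<inter> space M) \<inter> E)"
        using cyl[OF I B] E unfolding disintegrates_def by simp
      then show ?thesis using \<mu>[of C] \<mu>'[of C] C cyl_sets by (metis (no_types, lifting) subsetD)
    qed
    have "emeasure ?\<mu> B = emeasure ?\<mu>' B"
    proof (rule emeasure_eq_on_sigma_sets[OF obs.Int_stable_cylinders])
      show "?\<C> \<subseteq> sets ?\<mu>" using cyl_sets by simp
      show "B \<in> sigma_sets (space ?\<mu>) ?\<C>" using B by (simp add: sets_proj_lim)
      show "finite_measure ?\<mu>"
        by (rule finite_measureI) (use \<mu>[OF sets.top] in simp)
      obtain I where I: "I \<in> D" using obs.D_nonempty by blast
      have "proj_lim_set D XS f = (\<lambda>x. x I) -` topspace (XS I) \<inter> proj_lim_set D XS f"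
        using proj_lim_setD[OF _ I] by blast
      then have "proj_lim_set D XS f \<in> ?\<C>"
        using I sets.top[of "borel_of (XS I)"] by auto
      then show "emeasure ?\<mu> (space ?\<mu>) = emeasure ?\<mu>' (space ?\<mu>)" using eq by simp
    qed (simp_all add: eq)
    then show "(\<integral>\<^sup>+\<omega>\<in>E. ennreal (measure (k \<omega>) (XD -` B \<inter> space M)) \<partial>M) = emeasure M ((XD -` B \<inter> space M) \<inter> E)"
      unfolding \<mu>[OF B] \<mu>'[OF B] by (rule sym)
  qed
  show ?thesis
    unfolding sufficient_iff_disintegrates[OF \<Theta>D_measurable XD_measurable]
    by (intro conjI bexI[of _ k] ballI SD(1) kM main k_meas measurable_sets[OF XD_measurable])
qed

lemma limit_minimal_sufficient:
  assumes Q: "cond_prob_given M (proj_lim D TS g) \<Theta>D Q"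
    and min: "\<And>I. I \<in> D \<Longrightarrow> minimal_sufficient M (borel_of (XS I)) (X I) (borel_of (TS I)) (\<Theta> I) (S I)"
  shows "minimal_sufficient M (proj_lim D XS f) XD (proj_lim D TS g) \<Theta>D
    (sigma (space M) (\<Union>I\<in>D. sets (S I)))"
proof (rule minimal_sufficientI[OF limit_sufficient[OF Q min] Q \<Theta>D_measurable])
  fix C assume C: "sufficient M (proj_lim D XS f) XD (proj_lim D TS g) \<Theta>D C"
  have CM: "subalgebra M C" using C by (simp add: sufficient_def)
  have S: "sets (S I) \<subseteq> null_closure M C" if I: "I \<in> D" for I
  proof (rule minimal_sufficient_subset_null_closure[OF min[OF I] _ \<Theta>_measurable[OF I]])
    show "sufficient M (borel_of (XS I)) (X I) (borel_of (TS I)) (\<Theta> I) C"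
      by (rule sufficient_coarser[OF C \<Theta>D_measurable XD_measurable
            measurable_proj_lim_coordinate[OF I] _ measurable_proj_lim_coordinate[OF I]])
         (simp_all add: proj_lim_var_def I)
  qed
  have "(\<Union>I\<in>D. sets (S I)) \<subseteq> sets M" using S unfolding null_closure_def by blast
  from subalgebra_sigma(2)[OF this] show "sets (sigma (space M) (\<Union>I\<in>D. sets (S I))) \<subseteq> null_closure M C"
    using S by (simp add: sigma_sets_subset_null_closure[OF CM] UN_least)
qed

end

theorem proposition3:
  fixes M :: "'w measure" and D :: "'i::order set"
    and XS :: "'i \<Rightarrow> 'x topology" and f :: "'i \<Rightarrow> 'i \<Rightarrow> 'x \<Rightarrow> 'x"
    and TS :: "'i \<Rightarrow> 't topology" and g :: "'i \<Rightarrow> 'i \<Rightarrow> 't \<Rightarrow> 't"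
    and X :: "'i \<Rightarrow> 'w \<Rightarrow> 'x" and \<Theta> :: "'i \<Rightarrow> 'w \<Rightarrow> 't"
    and P :: "'i \<Rightarrow> 'w \<Rightarrow> 'x measure" and PD :: "'w \<Rightarrow> ('i \<Rightarrow> 'x) measure"
    and S :: "'i \<Rightarrow> 'w measure"
  assumes "projective_limit_model M D XS f TS g X \<Theta> P PD"
    and "\<exists>Q. cond_prob_given M (proj_lim D TS g) (proj_lim_var D \<Theta>) Q"
    and "\<And>I. I \<in> D \<Longrightarrow> subalgebra M (S I)"
    and "\<And>I J. I \<in> D \<Longrightarrow> J \<in> D \<Longrightarrow> I \<le> J \<Longrightarrow> sets (S I) \<subseteq> sets (S J)"
    and "\<And>I. I \<in> D \<Longrightarrow>
      minimal_sufficient M (borel_of (XS I)) (X I) (borel_of (TS I)) (\<Theta> I) (S I)"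
  shows "minimal_sufficient M (proj_lim D XS f) (proj_lim_var D X)
    (proj_lim D TS g) (proj_lim_var D \<Theta>) (sigma (space M) (\<Union>I\<in>D. sets (S I)))"
proof -
  interpret projective_limit_model M D XS f TS g X \<Theta> P PD by (rule assms(1))
  obtain Q where "cond_prob_given M (proj_lim D TS g) \<Theta>D Q" using assms(2) by blast
  then show ?thesis using assms(5) by (rule limit_minimal_sufficient)
qed

end
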